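(* For each $n$, let $\lambda=(\lambda_1,\ldots,\lambda_I)$ and $\mu=(\mu_1,\ldots,\mu_J)$ be two partitions of $n$ (depending on $n$) such that $I=o(n)$. Let $\sigma\in S_n$ be a permutation chosen uniformly at random from a fixed double coset in $S_\lambda\backslash S_n/S_\mu$. Let $d\leq\frac{\lambda_I}{2}$ be a fixed positive integer. Let $W_n:=\frac{\mathrm{des}_d(\sigma)-\mu_n}{\sigma_n}$, where $\mu_n:=E(\mathrm{des}_d(\sigma))$ and $\sigma_n^2:=\mathrm{Var}(\mathrm{des}_d(\sigma))$. Then $$d_K(W_n,Z)\leq O(n^{-1/2}),$$ where $Z$ is a standard normal random variable, so that $W_n$ converges in distribution to $Z$ as $n\to\infty$.
   Context: A partition $\lambda=(\lambda_1,\ldots,\lambda_I)$ of $n$ satisfies $\lambda_1\ge\dots\ge\lambda_I>0$ and $\lambda_1+\dots+\lambda_I=n$. Its $\lambda_i$-block is $L_i=\{\lambda_1+\dots+\lambda_{i-1}+1,\ldots,\lambda_1+\dots+\lambda_i\}$; the $\mu_j$-block $M_j$ is defined analogously for $\mu=(\mu_1,\ldots,\mu_J)$. The parabolic subgroup $S_\lambda\cong S_{\lambda_1}\times\dots\times S_{\lambda_I}$ is the set of permutations in $S_n$ preserving each block $L_i$ (similarly $S_\mu$). For $\sigma\in S_n$, the contingency table $T(\sigma)$ is the $I\times J$ table whose entry $T_{ij}$ is the number of elements of $M_j$ occurring in the positions of $\sigma$ given by $L_i$, i.e. $T_{ij}=|\{p\in L_i:\sigma(p)\in M_j\}|$; it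 has row sums $\lambda$ and column sums $\mu$. The parabolic double cosets in $S_\lambda\backslash S_n/S_\mu$ are in bijection with the nonnegative integer tables with row sums $\lambda$ and column sums $\mu$; the double coset indexed by $T$ is the set of all $\sigma\in S_n$ with $T(\sigma)=T$. A pair $(i,j)\in[n]^2$ is a $d$-descent of $\sigma$ if $i<j\le i+d$ and $\sigma(i)>\sigma(j)$; $\mathrm{des}_d(\sigma)$ is the number of $d$-descents of $\sigma$. $d_K(X,Y)=\sup_{x\in\mathbb{R}}|P(X\le x)-P(Y\le x)|$ is the Kolmogorov distance. $a_n=O(b_n)$ means there are positive constants $c,n_0$ with $a_n\le cb_n$ for all $n\ge n_0$. *)

theory Defs
  imports
    "HOL-Probability.Probability"
    "HOL-Combinatorics.Combinatorics"
    "HOL-Library.Landau_Symbols"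
begin

definition is_partition :: "nat list \<Rightarrow> nat \<Rightarrow> bool" where
  "is_partition l n \<longleftrightarrow> sorted_wrt (\<ge>) l \<and> (\<forall>x\<in>set l. 0 < x) \<and> sum_list l = n"

text \<open>List indices start at 0, whereas positions and values range over \<open>{1..n}\<close>; so
  \<open>block l i\<close> is the block belonging to the part with mathematical index \<open>i + 1\<close>.\<close>

definition block :: "nat list \<Rightarrow> nat \<Rightarrow> nat set" where
  "block l i = {sum_list (take i l) + 1 .. sum_list (take (Suc i) l)}"

definition parabolic :: "nat list \<Rightarrow> (nat \<Rightarrow> nat) set" where
  "parabolic l =
    {s. s permutes {1..sum_list l} \<and> (\<forall>i<length l. s ` block l i = block l i)}"

text \<open>Products of permutations are read from left to right: in \<open>a s b\<close> the factor
  \<open>a\<close> (from the subgroup of \<open>lam\<close>) acts first, on positions, and \<open>b\<close> (from the subgroup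
  of \<open>mu\<close>) acts last, on values. This is the convention under which the double coset of
  \<open>s\<close> is the set of permutations with the same contingency table as \<open>s\<close>, where rows count
  positions and columns count values; see \<open>double_coset_eq_table_fibre\<close> below.\<close>

definition double_coset :: "nat list \<Rightarrow> nat list \<Rightarrow> (nat \<Rightarrow> nat) \<Rightarrow> (nat \<Rightarrow> nat) set" where
  "double_coset lam mu s = {b \<circ> s \<circ> a | a b. a \<in> parabolic lam \<and> b \<in> parabolic mu}"

definition double_cosets :: "nat \<Rightarrow> nat list \<Rightarrow> nat list \<Rightarrow> (nat \<Rightarrow> nat) set set" where
  "double_cosets n lam mu = {double_coset lam mu s | s. s permutes {1..n}}"

definition table :: "nat list \<Rightarrow> nat list \<Rightarrow> (nat \<Rightarrow> nat) \<Rightarrow> nat \<Rightarrow> nat \<Rightarrow> nat" where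
  "table lam mu s i j = card {p \<in> block lam i. s p \<in> block mu j}"

definition des :: "nat \<Rightarrow> nat \<Rightarrow> (nat \<Rightarrow> nat) \<Rightarrow> nat" where
  "des d n s = card {(i, j). i \<in> {1..n} \<and> j \<in> {1..n} \<and> i < j \<and> j \<le> i + d \<and> s i > s j}"

definition des_mean :: "nat \<Rightarrow> nat \<Rightarrow> (nat \<Rightarrow> nat) set \<Rightarrow> real" where
  "des_mean d n D = measure_pmf.expectation (pmf_of_set D) (\<lambda>s. real (des d n s))"

definition des_sd :: "nat \<Rightarrow> nat \<Rightarrow> (nat \<Rightarrow> nat) set \<Rightarrow> real" where
  "des_sd d n D = sqrt (measure_pmf.variance (pmf_of_set D) (\<lambda>s. real (des d n s)))"

definition W :: "nat \<Rightarrow> nat \<Rightarrow> (nat \<Rightarrow> nat) set \<Rightarrow> (nat \<Rightarrow> nat) \<Rightarrow> real" where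
  "W d n D s = (real (des d n s) - des_mean d n D) / des_sd d n D"

definition W_law :: "nat \<Rightarrow> nat \<Rightarrow> (nat \<Rightarrow> nat) set \<Rightarrow> real measure" where
  "W_law d n D = distr (measure_pmf (pmf_of_set D)) borel (W d n D)"

text \<open>Kolmogorov distance of two real random variables, as a function of their laws.\<close>

definition kolmogorov_dist :: "real measure \<Rightarrow> real measure \<Rightarrow> real" where
  "kolmogorov_dist M N = (SUP x. \<bar>cdf M x - cdf N x\<bar>)"


lemma sum_list_take_mono:
  fixes l :: "nat list"
  assumes "i \<le> j"
  shows "sum_list (take i l) \<le> sum_list (take j l)"
proof -
  have "take j l = take i l @ take (j - i) (drop i l)"
    using assms by (metis le_add_diff_inverse take_add)
  then show ?thesis by simp
qed

lemma block_unique: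
  assumes "p \<in> block l i" "p \<in> block l j"
  shows "i = j"
proof (rule ccontr)
  assume "i \<noteq> j"
  then consider "Suc i \<le> j" | "Suc j \<le> i" by linarith
  then show False
    using assms sum_list_take_mono[of "Suc i" j l] sum_list_take_mono[of "Suc j" i l]
    unfolding block_def by cases auto
qed

lemma block_subset: "block l i \<subseteq> {1..sum_list l}"
proof -
  have "sum_list (take k l) \<le> sum_list l" for k
    by (metis append_take_drop_id le_add1 sum_list_append)
  then show ?thesis unfolding block_def by (auto intro: order_trans)
qed

lemma block_cover:
  assumes "p \<in> {1..sum_list l}"
  obtains i where "i < length l" "p \<in> block l i"
proof -
  define k where "k = (LEAST k. p \<le> sum_list (take k l))"
  have ex: "p \<le> sum_list (take (length l) l)" using assms by simp
  have k: "p \<le> sum_list (take k l)" unfolding k_def by (rule LeastI[of _ "length l"]) (rule ex)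
  have kl: "k \<le> length l" unfolding k_def by (rule Least_le) (rule ex)
  have "k \<noteq> 0" using k assms by (cases k) auto
  then obtain i where i: "k = Suc i" using not0_implies_Suc by blast
  have "\<not> p \<le> sum_list (take i l)"
    using i not_less_Least[of i "\<lambda>k. p \<le> sum_list (take k l)"] unfolding k_def by simp
  then show thesis using that[of i] k kl i unfolding block_def by auto
qed

definition block_index :: "nat list \<Rightarrow> nat \<Rightarrow> nat" where
  "block_index l p = (THE i. p \<in> block l i)"

lemma block_index_eq: "p \<in> block l i \<Longrightarrow> block_index l p = i"
  unfolding block_index_def using block_unique by blast

lemma block_index_iff:
  assumes "p \<in> {1..sum_list l}"
  shows "p \<in> block l i \<longleftrightarrow> block_index l p = i"
  using assms block_cover block_index_eq by metis

lemma block_index_less: "p \<in> {1..sum_list l} \<Longrightarrow> block_index l p < length l"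
  using block_cover block_index_eq by metis

lemma parabolic_iff:
  "s \<in> parabolic l \<longleftrightarrow> s permutes {1..sum_list l} \<and>
    (\<forall>p\<in>{1..sum_list l}. block_index l (s p) = block_index l p)"
proof (cases "s permutes {1..sum_list l}")
  case True
  have s: "s p \<in> {1..sum_list l} \<longleftrightarrow> p \<in> {1..sum_list l}" for p
    by (rule permutes_in_image[OF True])
  have "(\<forall>i<length l. s ` block l i = block l i) \<longleftrightarrow>
    (\<forall>p\<in>{1..sum_list l}. block_index l (s p) = block_index l p)" (is "?L \<longleftrightarrow> ?R")
  proof
    assume ?L
    show ?R
    proof
      fix p assume p: "p \<in> {1..sum_list l}"
      obtain i where "i < length l" "p \<in> block l i" using block_cover[OF p] .
      moreover from this have "s p \<in> block l i" using \<open>?L\<close> by blast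
      ultimately show "block_index l (s p) = block_index l p" by (simp add: block_index_eq)
    qed
  next
    assume R: ?R
    show ?L
    proof (intro allI impI)
      fix i
      have "s p \<in> block l i" if "p \<in> block l i" for p
      proof -
        have "p \<in> {1..sum_list l}" using that block_subset by blast
        then show ?thesis using R s that block_index_iff by metis
      qed
      then have "s ` block l i \<subseteq> block l i" by blast
      moreover have "finite (block l i)" unfolding block_def by simp
      moreover have "inj_on s (block l i)" using permutes_inj_on[OF True] .
      ultimately show "s ` block l i = block l i" by (simp add: endo_inj_surj)
    qed
  qed
  then show ?thesis using True unfolding parabolic_def by simp
qed (simp add: parabolic_def)

lemma double_coset_eq_table_fibre:
  assumes lam: "sum_list lam = n" and mu: "sum_list mu = n" and s: "s permutes {1..n}"
  shows "double_coset lam mu s =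
    {t. t permutes {1..n} \<and>
        (\<forall>i<length lam. \<forall>j<length mu. table lam mu t i j = table lam mu s i j)}"
proof (intro equalityI subsetI)
  fix t assume "t \<in> double_coset lam mu s"
  then obtain a b where t: "t = b \<circ> s \<circ> a" and a: "a \<in> parabolic lam" and b: "b \<in> parabolic mu"
    unfolding double_coset_def by blast
  have pa: "a permutes {1..n}" and pb: "b permutes {1..n}"
    using a b lam mu unfolding parabolic_def by auto
  have "t permutes {1..n}" unfolding t by (intro permutes_compose pa pb s)
  moreover have "table lam mu t i j = table lam mu s i j" if "i < length lam" for i j
  proof -
    let ?T = "{p \<in> block lam i. t p \<in> block mu j}" and ?S = "{p \<in> block lam i. s p \<in> block mu j}"
    have ai: "a ` block lam i = block lam i" using a that unfolding parabolic_def by blast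
    have eq: "t p \<in> block mu j \<longleftrightarrow> s (a p) \<in> block mu j" if "p \<in> block lam i" for p
    proof -
      have "p \<in> {1..n}" using that block_subset lam by blast
      then have q: "s (a p) \<in> {1..n}" using pa s by (simp only: permutes_in_image)
      then have "b (s (a p)) \<in> {1..n}" using pb by (simp only: permutes_in_image)
      then show ?thesis using q b mu unfolding t parabolic_iff
        by (simp add: block_index_iff)
    qed
    have "a ` ?T = ?S"
    proof (intro equalityI subsetI)
      fix q assume "q \<in> ?S"
      then obtain p where "p \<in> block lam i" "q = a p" using ai by blast
      with \<open>q \<in> ?S\<close> show "q \<in> a ` ?T" using eq by blast
    next
      fix q assume "q \<in> a ` ?T"
      then show "q \<in> ?S" using eq ai by blast
    qed
    moreover have "inj_on a ?T" using permutes_inj_on[OF pa] .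
    ultimately show ?thesis unfolding table_def using card_image[of a ?T] by simp
  qed
  ultimately show "t \<in> {t. t permutes {1..n} \<and>
        (\<forall>i<length lam. \<forall>j<length mu. table lam mu t i j = table lam mu s i j)}" by blast
next
  fix t assume "t \<in> {t. t permutes {1..n} \<and>
        (\<forall>i<length lam. \<forall>j<length mu. table lam mu t i j = table lam mu s i j)}"
  then have t: "t permutes {1..n}"
    and tab: "\<And>i j. i < length lam \<Longrightarrow> j < length mu \<Longrightarrow> table lam mu t i j = table lam mu s i j"
    by auto
  define f where "f = (\<lambda>u p. (block_index lam p, block_index mu (u p)))"
  have cnt: "count (image_mset (f u) (mset_set {1..n})) (i, j) =
      (if i < length lam \<and> j < length mu then table lam mu u i j else 0)"
    if u: "u permutes {1..n}" for u i j
  proof -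
    have "count (image_mset (f u) (mset_set {1..n})) (i, j) = card (f u -` {(i, j)} \<inter> {1..n})"
      by (simp add: count_image_mset)
    also have "f u -` {(i, j)} \<inter> {1..n} =
        {p \<in> {1..n}. block_index lam p = i \<and> block_index mu (u p) = j}"
      unfolding f_def by auto
    also have "\<dots> = {p \<in> {1..n}. p \<in> block lam i \<and> u p \<in> block mu j}"
    proof (rule Collect_cong, rule conj_cong[OF refl])
      fix p assume p: "p \<in> {1..n}"
      then have "u p \<in> {1..n}" by (simp only: permutes_in_image[OF u])
      then show "(block_index lam p = i \<and> block_index mu (u p) = j) =
          (p \<in> block lam i \<and> u p \<in> block mu j)"
        using p block_index_iff[of p lam i] block_index_iff[of "u p" mu j] lam mu by simp
    qed
    also have "\<dots> = {p \<in> block lam i. u p \<in> block mu j}"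
      using block_subset[of lam i] lam by blast
    finally have 1: "count (image_mset (f u) (mset_set {1..n})) (i, j) = table lam mu u i j"
      unfolding table_def .
    moreover have "block lam i = {}" if "\<not> i < length lam"
      using that by (auto simp: block_def)
    moreover have "block mu j = {}" if "\<not> j < length mu"
      using that by (auto simp: block_def)
    ultimately show ?thesis by (auto simp: table_def)
  qed
  have "image_mset (f t) (mset_set {1..n}) = image_mset (f s) (mset_set {1..n})"
  proof (rule multiset_eqI)
    fix x show "count (image_mset (f t) (mset_set {1..n})) x = count (image_mset (f s) (mset_set {1..n})) x"
      by (cases x) (simp add: cnt[OF t] cnt[OF s] tab del: One_nat_def)
  qed
  then obtain a where a: "a permutes {1..n}" and fa: "\<forall>x\<in>{1..n}. f t x = f s (a x)"
    using image_mset_eq_implies_permutes[of "{1..n}" "f t" "f s"] by auto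
  define b where "b = t \<circ> inv a \<circ> inv s"
  have pb: "b permutes {1..n}"
    unfolding b_def by (intro permutes_compose permutes_inv a s t)
  have b_eq: "b (s (a p)) = t p" for p
    unfolding b_def by (simp add: permutes_inverses[OF a] permutes_inverses[OF s])
  have "a \<in> parabolic lam" using a fa lam unfolding parabolic_iff f_def by simp
  moreover have "b \<in> parabolic mu"
  proof -
    have "block_index mu (b y) = block_index mu y" if "y \<in> {1..n}" for y
    proof -
      define p where "p = inv a (inv s y)"
      have y: "y = s (a p)" unfolding p_def
        by (simp add: permutes_inverses[OF a] permutes_inverses[OF s])
      then have "p \<in> {1..n}" using that a s by (simp only: permutes_in_image)
      then show ?thesis using fa b_eq unfolding y f_def by simp
    qed
    then show ?thesis using pb mu unfolding parabolic_iff by simp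
  qed
  moreover have "t = b \<circ> s \<circ> a" using b_eq by (simp add: fun_eq_iff)
  ultimately show "t \<in> double_coset lam mu s" unfolding double_coset_def by blast
qed

end

theory Submission
  imports Defs "HOL-Real_Asymp.Real_Asymp"
begin

text \<open>
  Stein's method, with a coupling built from transpositions. Write \<open>S\<close> for the number of
  \<open>d\<close>-descents, a sum of indicators over pairs of close positions. For a pair in one row, the centred
  indicator changes sign when the two entries are exchanged. For a pair \<open>(p, q)\<close> in different rows,
  average over all \<open>x\<close> in the row of \<open>p\<close> and \<open>y\<close> in the row of \<open>q\<close>: the difference of the indicators at
  \<open>(p, q)\<close> and \<open>(x, y)\<close> changes sign when \<open>p, x\<close> and \<open>q, y\<close> are exchanged, and the averaged
  indicator is, up to a constant determined by the contingency table, a sum over pairs \<open>(x, y)\<close> with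
  values in one column, for which exchanging the two values stays in the double coset. Hence \<open>S - E S\<close> is a sum of terms
  \<open>G k\<close>, each antisymmetric under an involution \<open>act k\<close> of the double coset, and
  \<open>E ((S - E S) f(S)) = E (\<Sum>k. G k / 2 * (f(S) - f(S \<circ> act k)))\<close>. With a smoothed Stein
  equation this bounds the Kolmogorov distance by a multiple of \<open>n powr (-1/2)\<close>, provided that the variance of
  \<open>H = \<Sum>k. G k / 2 * (S - S \<circ> act k)\<close> is \<open>O(n)\<close> and the variance of \<open>S\<close> is at least of order \<open>n\<close>.
  The first holds since \<open>H\<close> changes by a bounded amount when two entries are changed, by a Poincare
  inequality on Young subgroups. The second comes from exchanging adjacent entries in disjoint windows
  inside the rows: the resulting gains are orthogonal to each other and correlated with \<open>S\<close>, and since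
  the number of rows is \<open>o(n)\<close> there are linearly many such windows.
\<close>

section \<open>Stein's equation for the standard normal distribution\<close>

lemma std_normal_density_has_derivative:
  "(std_normal_density has_real_derivative - x * std_normal_density x) (at x)"
proof -
  have "((\<lambda>x. (1 / sqrt (2 * pi)) * exp (- x\<^sup>2 / 2)) has_real_derivative
      - x * std_normal_density x) (at x)"
    by (auto intro!: derivative_eq_intros simp: std_normal_density_def field_simps)
  then show ?thesis by (simp add: std_normal_density_def[abs_def])
qed

lemma std_normal_density_pos: "0 < std_normal_density x"
  by (simp add: normal_density_pos)

lemma std_normal_density_le_1: "std_normal_density x \<le> 1"
proof -
  have "1 \<le> sqrt (2 * pi)" using pi_gt3 by (simp add: real_le_rsqrt)
  then have "1 / sqrt (2 * pi) \<le> 1" by simp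
  moreover have "exp (- x\<^sup>2 / 2) \<le> 1" by simp
  ultimately show ?thesis unfolding std_normal_density_def
    by (intro mult_le_one) auto
qed

text \<open>Controls the Stein solution near 0, where the tail estimate degenerates; 6 comes from
  sqrt (2 * pi) \<le> 3 and exp (1/2) \<le> 2.\<close>

lemma inverse_std_normal_density_le:
  assumes "\<bar>x\<bar> \<le> 1"
  shows "1 / std_normal_density x \<le> 6"
proof -
  have "sqrt (2 * pi) \<le> 3"
    by (rule real_le_lsqrt) (use pi_less_4 in auto)
  moreover have "exp (x\<^sup>2 / 2) \<le> 2"
  proof -
    have "x\<^sup>2 \<le> 1" using assms by (simp add: abs_square_le_1)
    then have "exp (x\<^sup>2 / 2) \<le> exp (1/2)" by simp
    also have "exp (1/2) \<le> (2::real)"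
    proof (rule power2_le_imp_le)
      show "(exp (1/2))\<^sup>2 \<le> (2::real)\<^sup>2"
        using exp_le by (simp flip: exp_double)
    qed simp
    finally show ?thesis .
  qed
  ultimately have "sqrt (2 * pi) * exp (x\<^sup>2 / 2) \<le> 3 * 2"
    by (intro mult_mono) auto
  then show ?thesis
    by (simp add: std_normal_density_def exp_minus field_simps)
qed

text \<open>Mills' ratio: up to sign \<open>g w\<close> is the integral of \<open>k\<close> against
  the density over the upper tail. The comparison function \<open>\<psi>\<close> decreases to its
  limit 0, hence is nonnegative; the two values of \<open>c\<close> give the two halves of the
  absolute value.\<close>

lemma gaussian_tail_bound:
  fixes g k :: "real \<Rightarrow> real"
  assumes g: "\<And>x. (g has_real_derivative k x * std_normal_density x) (at x)"
    and k: "\<And>x. \<bar>k x\<bar> \<le> 1" and lim: "(g \<longlongrightarrow> 0) at_top" and w: "0 < w"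
  shows "\<bar>g w\<bar> \<le> std_normal_density w / w"
proof -
  have *: "c * g w \<le> std_normal_density w / w" if c: "c = 1 \<or> c = -1" for c
  proof -
    define \<psi> where "\<psi> x = std_normal_density x / x - c * g x" for x
    have "eventually (\<lambda>x. \<psi> x \<le> \<psi> w) at_top"
      using eventually_ge_at_top[of w]
    proof eventually_elim
      case (elim x)
      show ?case
      proof (rule DERIV_nonpos_imp_nonincreasing[OF elim])
        fix y assume y: "w \<le> y" "y \<le> x"
        let ?D = "((- y * std_normal_density y) * y - std_normal_density y * 1) / (y * y)
          - c * (k y * std_normal_density y)"
        have "(\<psi> has_real_derivative ?D) (at y)"
          unfolding \<psi>_def[abs_def] using w y
          by (intro DERIV_diff DERIV_divide DERIV_ident DERIV_cmult g std_normal_density_has_derivative) auto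
        moreover have "?D = - std_normal_density y * (1 + c * k y) - std_normal_density y / (y * y)"
          using w y by (simp add: field_simps)
        moreover have "\<dots> \<le> 0"
        proof -
          have "0 \<le> 1 + c * k y" using c k[of y] by (auto simp: abs_le_iff)
          then have "0 \<le> std_normal_density y * (1 + c * k y)" by simp
          moreover have "0 \<le> std_normal_density y / (y * y)" by simp
          ultimately show ?thesis by linarith
        qed
        ultimately show "\<exists>D. (\<psi> has_real_derivative D) (at y) \<and> D \<le> 0" by auto
      qed
    qed
    moreover have "(\<psi> \<longlongrightarrow> 0) at_top"
    proof -
      have "((\<lambda>x. std_normal_density x / x) \<longlongrightarrow> 0) at_top"
      proof (rule tendsto_sandwich[OF _ _ tendsto_const])
        show "((\<lambda>x. 1 / x :: real) \<longlongrightarrow> 0) at_top" by real_asymp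
        show "eventually (\<lambda>x. 0 \<le> std_normal_density x / x) at_top"
          using eventually_gt_at_top[of 0] by eventually_elim auto
        show "eventually (\<lambda>x. std_normal_density x / x \<le> 1 / x) at_top"
          using eventually_gt_at_top[of 0]
          by eventually_elim (auto intro!: divide_right_mono std_normal_density_le_1)
      qed
      from tendsto_diff[OF this tendsto_mult_left[OF lim, of c]]
      show ?thesis by (simp add: \<psi>_def[abs_def])
    qed
    ultimately have "0 \<le> \<psi> w"
      using tendsto_upperbound[of \<psi> 0 at_top "\<psi> w"] by simp
    then show ?thesis by (simp add: \<psi>_def)
  qed
  from *[of 1] *[of "-1"] show ?thesis by (simp add: abs_le_iff)
qed

interpretation std_normal: real_distribution std_normal_distribution
  by (rule real_dist_normal_dist)

section \<open>Gaussian primitives and the solution of Stein's equation\<close>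

lemma std_normal_integral_eq_set_integral:
  fixes k :: "real \<Rightarrow> real"
  assumes "k \<in> borel_measurable borel" and A: "A \<in> sets borel"
  shows "(\<integral>u. indicator A u * k u \<partial>std_normal_distribution) =
    (LINT u:A|lborel. k u * std_normal_density u)"
  using assms
  by (subst integral_density) (auto simp: set_lebesgue_integral_def mult_ac)

text \<open>The fundamental theorem of calculus is available on compact intervals, so the integral
  up to \<open>w - 1\<close> is split off as a constant; \<open>w\<close> is then interior to
  \<open>{w - 1..w + 1}\<close>.\<close>

lemma std_normal_primitive_has_derivative:
  fixes k :: "real \<Rightarrow> real"
  assumes cont: "continuous_on UNIV k" and bd: "\<And>x. \<bar>k x\<bar> \<le> 1"
  shows "((\<lambda>w. \<integral>u. indicator {..w} u * k u \<partial>std_normal_distribution)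
    has_real_derivative k w * std_normal_density w) (at w)"
proof -
  define K where "K u = k u * std_normal_density u" for u
  have mk: "k \<in> borel_measurable borel" by (rule borel_measurable_continuous_onI[OF cont])
  have mK: "K \<in> borel_measurable borel"
    unfolding K_def[abs_def] by (intro borel_measurable_times mk) simp
  have K_cont: "continuous_on S K" for S
    unfolding K_def std_normal_density_def
    by (intro continuous_intros continuous_on_subset[OF cont]) auto
  have int: "integrable lborel K"
  proof (rule Bochner_Integration.integrable_bound)
    show "integrable lborel std_normal_density" by simp
    show "AE x in lborel. norm (K x) \<le> norm (std_normal_density x)"
      unfolding K_def using bd by (auto simp: abs_mult intro!: mult_left_le_one_le)
  qed (simp add: mK)
  define g where "g w = (LINT u:{..w}|lborel. K u)" for w
  have g_eq: "(\<integral>u. indicator {..w} u * k u \<partial>std_normal_distribution) = g w" for w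
    unfolding g_def K_def by (rule std_normal_integral_eq_set_integral[OF mk]) auto
  have si: "set_integrable lborel A K" if "A \<in> sets borel" for A
    using int that unfolding set_integrable_def by (intro integrable_mult_indicator) auto
  have split: "g v = g (w - 1) + integral {w - 1..v} K" if "w - 1 \<le> v" for v
  proof -
    have "{..v} = {..w - 1} \<union> {w - 1<..v}" using that by auto
    then have "g v = g (w - 1) + (LINT u:{w - 1<..v}|lborel. K u)"
      unfolding g_def by (simp only:) (rule set_integral_Un, auto intro!: si)
    also have "(LINT u:{w - 1<..v}|lborel. K u) = (LINT u:{w - 1..v}|lborel. K u)"
      using that by (intro set_integral_cong_set) 
        (auto simp: set_borel_measurable_def intro!: borel_measurable_times mK AE_I[where N="{w-1}"])
    also have "\<dots> = integral {w - 1..v} K"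
      by (rule set_borel_integral_eq_integral) (rule si, simp)
    finally show ?thesis .
  qed
  have "((\<lambda>v. integral {w - 1..v} K) has_real_derivative K w) (at w within {w - 1..w + 1})"
    by (rule integral_has_real_derivative[OF K_cont]) auto
  then have "((\<lambda>v. integral {w - 1..v} K) has_real_derivative K w) (at w)"
    by (simp add: at_within_Icc_at)
  then have "((\<lambda>v. g (w - 1) + integral {w - 1..v} K) has_real_derivative K w) (at w)"
    by (auto intro!: derivative_eq_intros)
  then have "(g has_real_derivative K w) (at w)"
  proof (rule has_field_derivative_transform_within_open[where S="{w - 1<..}"])
  qed (auto simp: split[symmetric])
  then show ?thesis by (simp add: g_eq K_def)
qed


text \<open>The solution is the primitive of (h - E h) times the density, divided by the density.
  For \<bar>w\<bar> \<le> 1 the density is bounded below; for larger \<bar>w\<bar> the Mills bound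
  even gives \<bar>w * f w\<bar> \<le> 1.\<close>

lemma stein_solution:
  fixes h :: "real \<Rightarrow> real"
  assumes cont: "continuous_on UNIV h" and h: "\<And>x. 0 \<le> h x" "\<And>x. h x \<le> 1"
  obtains f where
    "\<And>w. (f has_real_derivative w * f w + (h w - (\<integral>u. h u \<partial>std_normal_distribution))) (at w)"
    "\<And>w. \<bar>f w\<bar> \<le> 6" "\<And>w. \<bar>w * f w\<bar> \<le> 6"
proof -
  let ?N = std_normal_distribution
  define c where "c = (\<integral>u. h u \<partial>?N)"
  have mh: "h \<in> borel_measurable borel" by (rule borel_measurable_continuous_onI[OF cont])
  have inth: "integrable ?N h"
    by (rule std_normal.integrable_const_bound[where B=1]) (use h mh in auto)
  have c: "0 \<le> c" "c \<le> 1"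
    unfolding c_def using h inth
    by (auto intro!: integral_nonneg_AE std_normal.integral_le_const)
  define k where "k x = h x - c" for x
  have k_bd: "\<bar>k x\<bar> \<le> 1" for x using h[of x] c unfolding k_def by auto
  have k_cont: "continuous_on UNIV k" unfolding k_def[abs_def] by (intro continuous_intros cont)
  have mk: "k \<in> borel_measurable borel" by (rule borel_measurable_continuous_onI[OF k_cont])
  have intk: "integrable ?N (\<lambda>u. indicator A u * k u)" if "A \<in> sets borel" for A
    by (rule std_normal.integrable_const_bound[where B=1])
      (use k_bd mk that in \<open>auto simp: abs_mult indicator_def\<close>)
  have bound: "\<bar>\<integral>u. indicator A u * k u \<partial>?N\<bar> \<le> measure ?N A" if A: "A \<in> sets borel" for A
  proof -
    have "\<bar>\<integral>u. indicator A u * k u \<partial>?N\<bar> \<le> (\<integral>u. \<bar>indicator A u * k u\<bar> \<partial>?N)"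
      by (rule integral_abs_bound)
    also have "\<dots> \<le> (\<integral>u. indicator A u \<partial>?N)"
    proof (rule integral_mono)
      show "integrable ?N (indicat_real A)"
        by (rule std_normal.integrable_const_bound[where B=1]) (use A in \<open>auto simp: indicator_def\<close>)
    qed (use intk[OF A] k_bd in \<open>auto simp: indicator_def\<close>)
    also have "\<dots> = measure ?N A" using A by simp
    finally show ?thesis .
  qed
  define g where "g w = (\<integral>u. indicator {..w} u * k u \<partial>?N)" for w
  have g_der: "(g has_real_derivative k w * std_normal_density w) (at w)" for w
    unfolding g_def[abs_def] by (rule std_normal_primitive_has_derivative[OF k_cont k_bd])
  have g_bot: "\<bar>g w\<bar> \<le> cdf ?N w" for w
    unfolding g_def cdf_def by (rule bound) simp
  \<comment> \<open>The total integral of \<open>k\<close> is 0, so \<open>g w\<close> is also minus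
    the upper tail integral and vanishes at both ends.\<close>
  have g_top: "\<bar>g w\<bar> \<le> 1 - cdf ?N w" for w
  proof -
    have "g w + (\<integral>u. indicator {w<..} u * k u \<partial>?N) = 
        (\<integral>u. indicator {..w} u * k u + indicator {w<..} u * k u \<partial>?N)"
      unfolding g_def by (rule Bochner_Integration.integral_add[symmetric]) (rule intk, simp)+
    also have "\<dots> = (\<integral>u. k u \<partial>?N)"
      by (rule Bochner_Integration.integral_cong) (auto simp: indicator_def)
    also have "\<dots> = 0"
      unfolding k_def c_def using inth by (simp add: std_normal.prob_space[simplified])
    finally have "\<bar>g w\<bar> = \<bar>\<integral>u. indicator {w<..} u * k u \<partial>?N\<bar>" by simp
    also have "\<dots> \<le> measure ?N {w<..}" by (rule bound) simp
    also have "{w<..} = space ?N - {..w}" by auto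
    also have "measure ?N \<dots> = 1 - cdf ?N w"
      unfolding cdf_def by (rule std_normal.prob_compl) simp
    finally show ?thesis .
  qed
  have lim_bot: "(g \<longlongrightarrow> 0) at_bot"
    by (rule Lim_null_comparison[OF _ std_normal.cdf_lim_at_bot]) (simp add: g_bot)
  have lim_top: "(g \<longlongrightarrow> 0) at_top"
  proof (rule Lim_null_comparison)
    show "((\<lambda>w. 1 - cdf ?N w) \<longlongrightarrow> 0) at_top"
      using tendsto_diff[OF tendsto_const std_normal.cdf_lim_at_top_prob, of 1] by simp
  qed (simp add: g_top)
  define f where "f w = g w / std_normal_density w" for w
  have pos: "w \<noteq> 0 \<Longrightarrow> \<bar>f w\<bar> \<le> 1 / \<bar>w\<bar>" for w
  proof -
    assume "w \<noteq> 0"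
    then consider "0 < w" | "0 < - w" by linarith
    then have "\<bar>g w\<bar> \<le> std_normal_density w / \<bar>w\<bar>"
    proof cases
      case 1
      then show ?thesis using gaussian_tail_bound[OF g_der k_bd lim_top, of w] by simp
    next
      case 2
      \<comment> \<open>Reflection turns the lower tail into an upper one; the chain rule puts a
        minus sign on \<open>k\<close>.\<close>
      have "\<bar>g (- (- w))\<bar> \<le> std_normal_density (- w) / (- w)"
      proof (rule gaussian_tail_bound[where k="\<lambda>x. - k (- x)"])
        fix x
        have "((\<lambda>x. g (- x)) has_real_derivative (k (- x) * std_normal_density (- x)) * (- 1)) (at x)"
          by (rule DERIV_chain'[OF _ g_der]) (auto intro!: derivative_eq_intros)
        then show "((\<lambda>x. g (- x)) has_real_derivative - k (- x) * std_normal_density x) (at x)"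
          by (simp add: std_normal_density_def)
        show "\<bar>- k (- x)\<bar> \<le> 1" using k_bd by simp
        show "((\<lambda>x. g (- x)) \<longlongrightarrow> 0) at_top"
          using lim_bot by (simp add: filterlim_at_bot_mirror)
      qed (rule 2)
      then show ?thesis using 2 by (simp add: std_normal_density_def)
    qed
    then show "\<bar>f w\<bar> \<le> 1 / \<bar>w\<bar>"
      unfolding f_def using std_normal_density_pos[of w] \<open>w \<noteq> 0\<close>
      by (simp add: abs_divide field_simps)
  qed
  have f_bd: "\<bar>f w\<bar> \<le> 6" for w
  proof (cases "\<bar>w\<bar> \<le> 1")
    case True
    have "\<bar>g w\<bar> \<le> 1" using g_bot[of w] std_normal.cdf_bounded_prob[of w] by linarith
    then have "\<bar>g w\<bar> * (1 / std_normal_density w) \<le> 1 * 6"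
      using inverse_std_normal_density_le[OF True] std_normal_density_pos[of w]
      by (intro mult_mono) auto
    then show ?thesis using std_normal_density_pos[of w] by (simp add: f_def abs_divide)
  next
    case False
    then have "\<bar>f w\<bar> \<le> 1 / \<bar>w\<bar>" by (intro pos) auto
    also have "\<dots> \<le> 1" using False by simp
    finally show ?thesis by simp
  qed
  show thesis
  proof (rule that)
    fix w
    have "(f has_real_derivative (k w * std_normal_density w * std_normal_density w
        - g w * (- w * std_normal_density w)) / (std_normal_density w * std_normal_density w)) (at w)"
      unfolding f_def[abs_def] using std_normal_density_pos[of w]
      by (intro DERIV_divide g_der std_normal_density_has_derivative) auto
    also have "(k w * std_normal_density w * std_normal_density w
        - g w * (- w * std_normal_density w)) / (std_normal_density w * std_normal_density w)
        = w * f w + (h w - c)"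
      using std_normal_density_pos[of w] by (simp add: f_def k_def field_simps)
    finally show "(f has_real_derivative w * f w + (h w - (\<integral>u. h u \<partial>?N))) (at w)"
      by (simp add: c_def)
    show "\<bar>f w\<bar> \<le> 6" by (rule f_bd)
    show "\<bar>w * f w\<bar> \<le> 6"
    proof (cases "\<bar>w\<bar> \<le> 1")
      case True
      then have "\<bar>w\<bar> * \<bar>f w\<bar> \<le> 1 * 6" by (intro mult_mono f_bd) auto
      then show ?thesis by (simp add: abs_mult)
    next
      case False
      then have "\<bar>w\<bar> * \<bar>f w\<bar> \<le> \<bar>w\<bar> * (1 / \<bar>w\<bar>)" by (intro mult_left_mono pos) auto
      then show ?thesis using False by (simp add: abs_mult split: if_splits)
    qed
  qed
qed

section \<open>Berry--Esseen bound for a Stein coupling\<close>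

definition avg :: "'a set \<Rightarrow> ('a \<Rightarrow> real) \<Rightarrow> real" where
  "avg A g = (\<Sum>x\<in>A. g x) / real (card A)"

lemma avg_cong: "(\<And>x. x \<in> A \<Longrightarrow> f x = g x) \<Longrightarrow> avg A f = avg A g"
  unfolding avg_def by (simp cong: sum.cong)

lemma avg_add: "avg A (\<lambda>x. f x + g x) = avg A f + avg A g"
  unfolding avg_def by (simp add: sum.distrib add_divide_distrib)

lemma avg_diff: "avg A (\<lambda>x. f x - g x) = avg A f - avg A g"
  unfolding avg_def by (simp add: sum_subtractf diff_divide_distrib)

lemma avg_cmult: "avg A (\<lambda>x. c * f x) = c * avg A f"
  unfolding avg_def by (simp add: sum_distrib_left)

lemma avg_divide: "avg A (\<lambda>x. f x / c) = avg A f / c"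
  using avg_cmult[of A "1 / c" f] by simp

lemma avg_sum: "avg A (\<lambda>x. \<Sum>k\<in>K. f k x) = (\<Sum>k\<in>K. avg A (f k))"
  unfolding avg_def by (subst sum.swap) (simp add: sum_divide_distrib)

lemma avg_mono: "(\<And>x. x \<in> A \<Longrightarrow> f x \<le> g x) \<Longrightarrow> avg A f \<le> avg A g"
  unfolding avg_def by (intro divide_right_mono sum_mono) auto

lemma avg_nonneg: "(\<And>x. x \<in> A \<Longrightarrow> 0 \<le> f x) \<Longrightarrow> 0 \<le> avg A f"
  unfolding avg_def by (intro divide_nonneg_nonneg sum_nonneg) auto

lemma avg_const: "finite A \<Longrightarrow> A \<noteq> {} \<Longrightarrow> avg A (\<lambda>_. c) = c"
  unfolding avg_def by simp

lemma avg_abs: "\<bar>avg A f\<bar> \<le> avg A (\<lambda>x. \<bar>f x\<bar>)"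
  unfolding avg_def by (simp add: abs_divide divide_right_mono)

lemma avg_bij: "bij_betw t A B \<Longrightarrow> avg A (\<lambda>x. f (t x)) = avg B f"
  unfolding avg_def by (simp add: sum.reindex_bij_betw bij_betw_same_card)

lemma avg_swap: "avg A (\<lambda>x. avg B (\<lambda>y. f x y)) = avg B (\<lambda>y. avg A (\<lambda>x. f x y))"
  unfolding avg_def sum_divide_distrib[symmetric]
  by (subst sum.swap) (simp add: mult.commute)

lemma avg_Cauchy_Schwarz: "(avg A (\<lambda>x. f x * g x))\<^sup>2 \<le> avg A (\<lambda>x. (f x)\<^sup>2) * avg A (\<lambda>x. (g x)\<^sup>2)"
  using Cauchy_Schwarz_ineq_sum[of f g A] unfolding avg_def
  by (simp add: power_divide power2_eq_square divide_right_mono)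

lemma avg_abs_le_sqrt:
  assumes "finite A" "A \<noteq> {}"
  shows "avg A (\<lambda>x. \<bar>f x\<bar>) \<le> sqrt (avg A (\<lambda>x. (f x)\<^sup>2))"
  using avg_Cauchy_Schwarz[of A "\<lambda>x. \<bar>f x\<bar>" "\<lambda>_. 1"] assms
  by (intro real_le_rsqrt) (simp add: avg_const)

lemma expectation_pmf_of_set_eq_avg:
  "finite A \<Longrightarrow> A \<noteq> {} \<Longrightarrow> measure_pmf.expectation (pmf_of_set A) f = avg A f"
  by (simp add: integral_pmf_of_set avg_def)

section \<open>The normal distribution function and smoothed indicators of half-lines\<close>

lemma cdf_std_normal_diff_le:
  assumes "a \<le> b"
  shows "cdf std_normal_distribution b - cdf std_normal_distribution a \<le> b - a"
proof (cases "a < b")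
  case True
  have "cdf std_normal_distribution b - cdf std_normal_distribution a
      = (\<integral>u. indicator {a<..b} u * 1 \<partial>std_normal_distribution)"
    using std_normal.cdf_diff_eq[OF True] by simp
  also have "\<dots> = (\<integral>u. indicator {a<..b} u * std_normal_density u \<partial>lborel)"
    by (subst std_normal_integral_eq_set_integral) (auto simp: set_lebesgue_integral_def)
  also have "\<dots> \<le> (\<integral>u. indicator {a<..b} u \<partial>lborel)"
  proof (rule integral_mono)
    show "integrable lborel (\<lambda>u. indicator {a<..b} u * std_normal_density u)"
      using integrable_mult_indicator[of "{a<..b}" lborel std_normal_density] by simp
    show "integrable lborel (\<lambda>u. indicator {a<..b} u :: real)"
      using True by (simp add: integrable_indicator_iff)
  qed (auto simp: indicator_def std_normal_density_le_1)
  also have "\<dots> = b - a" using True by simp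
  finally show ?thesis .
qed (use assms in auto)

text \<open>A continuous stand-in for the indicator of {..x}, as \<open>stein_solution\<close> needs
  a continuous test function. It falls linearly from 1 to 0 on the interval from \<open>x\<close> to
  \<open>x + \<delta>\<close>.\<close>

definition ramp :: "real \<Rightarrow> real \<Rightarrow> real \<Rightarrow> real" where
  "ramp x \<delta> w = max 0 (min 1 ((x + \<delta> - w) / \<delta>))"

lemma ramp_bounds: "0 \<le> ramp x \<delta> w" "ramp x \<delta> w \<le> 1"
  by (auto simp: ramp_def)

lemma ramp_eq_1: "0 < \<delta> \<Longrightarrow> w \<le> x \<Longrightarrow> ramp x \<delta> w = 1"
  by (simp add: ramp_def)

lemma ramp_eq_0: "0 < \<delta> \<Longrightarrow> x + \<delta> \<le> w \<Longrightarrow> ramp x \<delta> w = 0"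
  by (auto simp: ramp_def zero_le_divide_iff max_def min_def)

lemma continuous_on_ramp: "0 < \<delta> \<Longrightarrow> continuous_on S (ramp x \<delta>)"
  unfolding ramp_def[abs_def] by (intro continuous_intros) auto

lemma ramp_lipschitz: "0 < \<delta> \<Longrightarrow> \<bar>ramp x \<delta> v - ramp x \<delta> w\<bar> \<le> \<bar>v - w\<bar> / \<delta>"
proof -
  assume d: "0 < \<delta>"
  have "\<bar>ramp x \<delta> v - ramp x \<delta> w\<bar> \<le> \<bar>(x + \<delta> - v) / \<delta> - (x + \<delta> - w) / \<delta>\<bar>"
    unfolding ramp_def by (auto simp: max_def min_def abs_if)
  also have "\<dots> = \<bar>v - w\<bar> / \<delta>"
    using d by (simp add: diff_divide_distrib[symmetric] abs_divide abs_minus_commute)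
  finally show ?thesis .
qed

text \<open>The ramp is flat on either side of its slope, so nearby points are separated only close
  to the slope. Keeping the indicator leaves a small probability in the error term in place of a
  bare factor \<open>\<beta> / \<delta>\<close>.\<close>

lemma ramp_local:
  assumes "0 < \<delta>" "\<bar>v - w\<bar> \<le> \<beta>" "0 < \<beta>"
  shows "\<bar>ramp x \<delta> v - ramp x \<delta> w\<bar> \<le> \<beta> / \<delta> * of_bool (x - 2 * \<beta> < w \<and> w \<le> x + \<delta> + \<beta>)"
proof (cases "x - 2 * \<beta> < w \<and> w \<le> x + \<delta> + \<beta>")
  case True
  have "\<bar>v - w\<bar> / \<delta> \<le> \<beta> / \<delta>" using assms by (intro divide_right_mono) auto
  then show ?thesis using ramp_lipschitz[OF assms(1), of x v w] True by simp
next
  case False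
  then consider "w \<le> x" "v \<le> x" | "x + \<delta> \<le> w" "x + \<delta> \<le> v" using assms by linarith
  then have "ramp x \<delta> v = ramp x \<delta> w"
    using assms by cases (auto simp: ramp_eq_0 ramp_eq_1)
  then show ?thesis using assms by simp
qed

lemma integral_ramp_bounds:
  assumes "0 < \<delta>"
  shows "cdf std_normal_distribution x \<le> (\<integral>u. ramp x \<delta> u \<partial>std_normal_distribution)"
    and "(\<integral>u. ramp x \<delta> u \<partial>std_normal_distribution) \<le> cdf std_normal_distribution (x + \<delta>)"
proof -
  have int: "integrable std_normal_distribution (ramp x \<delta>)"
    by (rule std_normal.integrable_const_bound[where B=1])
      (use borel_measurable_continuous_onI[OF continuous_on_ramp[OF assms]] in \<open>auto simp: ramp_bounds\<close>)
  have ind: "integrable std_normal_distribution (\<lambda>u. indicat_real {..y} u)" for y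
    by (rule std_normal.integrable_const_bound[where B=1]) (auto simp: indicator_def)
  have cdf: "cdf std_normal_distribution y = (\<integral>u. indicat_real {..y} u \<partial>std_normal_distribution)" for y
    by (simp add: cdf_def)
  show "cdf std_normal_distribution x \<le> (\<integral>u. ramp x \<delta> u \<partial>std_normal_distribution)"
    unfolding cdf using assms
    by (intro integral_mono int ind) (auto simp: indicator_def ramp_eq_1 ramp_bounds)
  show "(\<integral>u. ramp x \<delta> u \<partial>std_normal_distribution) \<le> cdf std_normal_distribution (x + \<delta>)"
    unfolding cdf using assms
    by (intro integral_mono int ind) (auto simp: indicator_def ramp_eq_0 ramp_bounds)
qed

section \<open>Stein couplings on a finite uniform space\<close>

context
  fixes \<Omega> :: "'a set" and K :: "'k set" and X :: "'a \<Rightarrow> real"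
    and X' :: "'k \<Rightarrow> 'a \<Rightarrow> real" and G :: "'k \<Rightarrow> 'a \<Rightarrow> real" and \<alpha> \<beta> \<epsilon> :: real
  assumes fin: "finite \<Omega>" and ne: "\<Omega> \<noteq> {}"
    and stein: "\<And>f. avg \<Omega> (\<lambda>\<omega>. X \<omega> * f (X \<omega>)) =
      avg \<Omega> (\<lambda>\<omega>. \<Sum>k\<in>K. G k \<omega> * (f (X \<omega>) - f (X' k \<omega>)))"
    and close: "\<And>\<omega> k. \<omega> \<in> \<Omega> \<Longrightarrow> k \<in> K \<Longrightarrow> \<bar>X \<omega> - X' k \<omega>\<bar> \<le> \<beta>"
    and G_le: "\<And>\<omega>. \<omega> \<in> \<Omega> \<Longrightarrow> (\<Sum>k\<in>K. \<bar>G k \<omega>\<bar>) \<le> \<alpha>"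
    and pos: "0 < \<alpha>" "0 < \<beta>"
    and unit: "avg \<Omega> (\<lambda>\<omega>. (X \<omega>)\<^sup>2) = 1"
    and eps: "avg \<Omega> (\<lambda>\<omega>. \<bar>1 - (\<Sum>k\<in>K. G k \<omega> * (X \<omega> - X' k \<omega>))\<bar>) \<le> \<epsilon>"
begin

text \<open>Insert the Stein solution \<open>f\<close> of the ramp. The coupling identity rewrites E
  (X f(X)) by differences of \<open>f\<close>; replacing each by the jump times f'(X) leaves (1 - H)
  f'(X), which costs \<open>7 * \<epsilon>\<close>, plus remainders governed by the oscillation of
  f' over distance \<open>\<beta>\<close>.\<close>

lemma stein_coupling_smooth:
  assumes \<delta>: "0 < \<delta>"
  shows "\<bar>avg \<Omega> (\<lambda>\<omega>. ramp x \<delta> (X \<omega>)) - (\<integral>u. ramp x \<delta> u \<partial>std_normal_distribution)\<bar> \<le>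
    7 * \<epsilon> + 13 * \<alpha> * \<beta>\<^sup>2 +
    \<alpha> * \<beta>\<^sup>2 / \<delta> * avg \<Omega> (\<lambda>\<omega>. of_bool (x - 2 * \<beta> < X \<omega> \<and> X \<omega> \<le> x + \<delta> + \<beta>))"
proof -
  define c where "c = (\<integral>u. ramp x \<delta> u \<partial>std_normal_distribution)"
  define h where "h = ramp x \<delta>"
  obtain f where f: "\<And>w. (f has_real_derivative w * f w + (h w - c)) (at w)"
    and f6: "\<And>w. \<bar>f w\<bar> \<le> 6" "\<And>w. \<bar>w * f w\<bar> \<le> 6"
    using stein_solution[OF continuous_on_ramp[OF \<delta>] ramp_bounds] unfolding c_def h_def by metis
  define f' where "f' w = w * f w + (h w - c)" for w
  have c: "0 \<le> c" "c \<le> 1"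
    using integral_ramp_bounds[OF \<delta>, of x] std_normal.cdf_nonneg[of x]
      std_normal.cdf_bounded_prob[of "x + \<delta>"] unfolding c_def by linarith+
  have f'7: "\<bar>f' w\<bar> \<le> 7" for w
    using f6(2)[of w] ramp_bounds[where x=x and \<delta>=\<delta> and w=w] c unfolding f'_def h_def by linarith
  have f_lip: "\<bar>f v - f w\<bar> \<le> 7 * \<bar>v - w\<bar>" for v w
  proof -
    have "\<exists>z. f v - f w = (v - w) * f' z"
    proof (cases v w rule: linorder_cases)
      case less
      from MVT2[OF less, of f f'] f show ?thesis unfolding f'_def
        by (metis minus_diff_eq mult_minus_left)
    next
      case greater
      from MVT2[OF greater, of f f'] f show ?thesis unfolding f'_def by metis
    qed simp
    then obtain z where "f v - f w = (v - w) * f' z" ..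
    then show ?thesis using mult_left_mono[OF f'7[of z], of "\<bar>v - w\<bar>"] by (simp add: abs_mult mult.commute)
  qed
  define P where "P \<omega> = (of_bool (x - 2 * \<beta> < X \<omega> \<and> X \<omega> \<le> x + \<delta> + \<beta>) :: real)" for \<omega>
  define r where "r \<omega> = \<beta> * (6 * \<beta> + 7 * \<beta> * \<bar>X \<omega>\<bar> + \<beta> / \<delta> * P \<omega>)" for \<omega>
  have taylor: "\<bar>(X \<omega> - X' k \<omega>) * f' (X \<omega>) - (f (X \<omega>) - f (X' k \<omega>))\<bar> \<le> r \<omega>"
    if "\<omega> \<in> \<Omega>" "k \<in> K" for \<omega> k
  proof -
    let ?w = "X \<omega>" and ?v = "X' k \<omega>"
    have cl: "\<bar>?w - ?v\<bar> \<le> \<beta>" using close that by auto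
    have "\<exists>z. \<bar>z - ?w\<bar> \<le> \<beta> \<and> f ?w - f ?v = (?w - ?v) * f' z"
    proof (cases ?w ?v rule: linorder_cases)
      case less
      from MVT2[OF less, of f f'] f obtain z where "?w < z" "z < ?v" "f ?v - f ?w = (?v - ?w) * f' z"
        unfolding f'_def by metis
      then show ?thesis using cl by (intro exI[of _ z]) (auto simp: algebra_simps)
    next
      case greater
      from MVT2[OF greater, of f f'] f obtain z where "?v < z" "z < ?w" "f ?w - f ?v = (?w - ?v) * f' z"
        unfolding f'_def by metis
      then show ?thesis using cl by (intro exI[of _ z]) auto
    next
      case equal
      then show ?thesis using pos by (intro exI[of _ ?w]) auto
    qed
    then obtain z where z: "\<bar>z - ?w\<bar> \<le> \<beta>" "f ?w - f ?v = (?w - ?v) * f' z" by blast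
    \<comment> \<open>f' contains the ramp, which has corners, so no second derivative is used: the
      product w f(w) and the ramp are estimated separately.\<close>
    have "\<bar>f' z - f' ?w\<bar> \<le> 6 * \<beta> + 7 * \<beta> * \<bar>?w\<bar> + \<beta> / \<delta> * P \<omega>"
    proof -
      have "f' z - f' ?w = (z - ?w) * f z + ?w * (f z - f ?w) + (h z - h ?w)"
        unfolding f'_def by (simp add: algebra_simps)
      moreover have "\<bar>(z - ?w) * f z\<bar> \<le> \<beta> * 6"
        unfolding abs_mult using z f6 pos by (intro mult_mono) auto
      moreover have "\<bar>?w * (f z - f ?w)\<bar> \<le> \<bar>?w\<bar> * (7 * \<beta>)"
        unfolding abs_mult using z f_lip[of z ?w] by (intro mult_left_mono) auto
      moreover have "\<bar>h z - h ?w\<bar> \<le> \<beta> / \<delta> * P \<omega>"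
        unfolding h_def P_def using ramp_local[OF \<delta> z(1) pos(2)] .
      ultimately show ?thesis by (simp add: mult_ac)
    qed
    moreover have "\<bar>(?w - ?v) * f' ?w - (f ?w - f ?v)\<bar> = \<bar>?w - ?v\<bar> * \<bar>f' z - f' ?w\<bar>"
      unfolding z(2) right_diff_distrib[symmetric] abs_mult by (simp add: abs_minus_commute)
    ultimately show ?thesis
      unfolding r_def using cl pos by (simp only:) (intro mult_mono, auto)
  qed
  define H where "H \<omega> = (\<Sum>k\<in>K. G k \<omega> * (X \<omega> - X' k \<omega>))" for \<omega>
  have "avg \<Omega> (\<lambda>\<omega>. h (X \<omega>)) - c = avg \<Omega> (\<lambda>\<omega>. f' (X \<omega>) - X \<omega> * f (X \<omega>))"
    unfolding f'_def using fin ne by (simp add: avg_add avg_diff avg_const)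
  also have "\<dots> = avg \<Omega> (\<lambda>\<omega>. f' (X \<omega>)) - avg \<Omega> (\<lambda>\<omega>. \<Sum>k\<in>K. G k \<omega> * (f (X \<omega>) - f (X' k \<omega>)))"
    unfolding avg_diff stein ..
  also have "\<dots> = avg \<Omega> (\<lambda>\<omega>. (1 - H \<omega>) * f' (X \<omega>) +
      (\<Sum>k\<in>K. G k \<omega> * ((X \<omega> - X' k \<omega>) * f' (X \<omega>) - (f (X \<omega>) - f (X' k \<omega>)))))"
    unfolding avg_diff[symmetric] H_def
    by (intro avg_cong) (simp add: algebra_simps sum_subtractf sum.distrib sum_distrib_left sum_distrib_right)
  finally have "\<bar>avg \<Omega> (\<lambda>\<omega>. h (X \<omega>)) - c\<bar> \<le> avg \<Omega> (\<lambda>\<omega>. \<bar>(1 - H \<omega>) * f' (X \<omega>) +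
      (\<Sum>k\<in>K. G k \<omega> * ((X \<omega> - X' k \<omega>) * f' (X \<omega>) - (f (X \<omega>) - f (X' k \<omega>))))\<bar>)"
    by (simp only:) (rule avg_abs)
  also have "\<dots> \<le> avg \<Omega> (\<lambda>\<omega>. 7 * \<bar>1 - H \<omega>\<bar> + \<alpha> * r \<omega>)"
  proof (rule avg_mono)
    fix \<omega> assume w: "\<omega> \<in> \<Omega>"
    have r0: "0 \<le> r \<omega>" unfolding r_def P_def using pos \<delta> by auto
    have "\<bar>(1 - H \<omega>) * f' (X \<omega>)\<bar> \<le> 7 * \<bar>1 - H \<omega>\<bar>"
      using mult_left_mono[OF f'7, of "\<bar>1 - H \<omega>\<bar>" "X \<omega>"] by (simp add: abs_mult mult.commute)
    moreover have "\<bar>\<Sum>k\<in>K. G k \<omega> * ((X \<omega> - X' k \<omega>) * f' (X \<omega>) - (f (X \<omega>) - f (X' k \<omega>)))\<bar> \<le> \<alpha> * r \<omega>"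
    proof -
      have "\<bar>\<Sum>k\<in>K. G k \<omega> * ((X \<omega> - X' k \<omega>) * f' (X \<omega>) - (f (X \<omega>) - f (X' k \<omega>)))\<bar>
        \<le> (\<Sum>k\<in>K. \<bar>G k \<omega>\<bar> * r \<omega>)"
        by (rule order_trans[OF sum_abs]) (auto simp: abs_mult intro!: sum_mono mult_left_mono taylor w)
      also have "\<dots> \<le> \<alpha> * r \<omega>"
        unfolding sum_distrib_right[symmetric] by (intro mult_right_mono G_le w r0)
      finally show ?thesis .
    qed
    ultimately show "\<bar>(1 - H \<omega>) * f' (X \<omega>) +
      (\<Sum>k\<in>K. G k \<omega> * ((X \<omega> - X' k \<omega>) * f' (X \<omega>) - (f (X \<omega>) - f (X' k \<omega>))))\<bar>
      \<le> 7 * \<bar>1 - H \<omega>\<bar> + \<alpha> * r \<omega>" by linarith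
  qed
  also have "\<dots> = 7 * avg \<Omega> (\<lambda>\<omega>. \<bar>1 - H \<omega>\<bar>) + \<alpha> * (\<beta> * (6 * \<beta> +
      7 * \<beta> * avg \<Omega> (\<lambda>\<omega>. \<bar>X \<omega>\<bar>) + \<beta> / \<delta> * avg \<Omega> P))"
    unfolding r_def by (simp add: avg_add avg_cmult avg_divide avg_const[OF fin ne])
  \<comment> \<open>Unit second moment gives E \<bar>X\<bar> \<le> 1, so that the coefficient
    becomes 13 = 6 + 7.\<close>
  also have "\<dots> \<le> 7 * \<epsilon> + \<alpha> * (\<beta> * (6 * \<beta> + 7 * \<beta> * 1 + \<beta> / \<delta> * avg \<Omega> P))"
  proof (intro add_mono mult_left_mono)
    show "avg \<Omega> (\<lambda>\<omega>. \<bar>1 - H \<omega>\<bar>) \<le> \<epsilon>" using eps unfolding H_def .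
    show "avg \<Omega> (\<lambda>\<omega>. \<bar>X \<omega>\<bar>) \<le> 1" using avg_abs_le_sqrt[OF fin ne, of X] unit by simp
  qed (use pos \<delta> in auto)
  also have "\<dots> = 7 * \<epsilon> + 13 * \<alpha> * \<beta>\<^sup>2 + \<alpha> * \<beta>\<^sup>2 / \<delta> * avg \<Omega> P"
    by (simp add: algebra_simps power2_eq_square)
  finally show ?thesis unfolding h_def c_def P_def[abs_def] .
qed

text \<open>The bound on the smoothed distance contains the probability that \<open>X\<close> lies in a short interval,
  which is again controlled by the Kolmogorov distance. The ramp width \<open>4 * \<alpha> * \<beta>\<^sup>2\<close> makes the
  coefficient of that distance at most \<open>1/2\<close>, so that it can be absorbed.\<close>

lemma stein_coupling_bootstrap:
  assumes \<Delta>: "\<And>x. \<bar>avg \<Omega> (\<lambda>\<omega>. of_bool (X \<omega> \<le> x)) - cdf std_normal_distribution x\<bar> \<le> \<Delta>"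
  shows "\<bar>avg \<Omega> (\<lambda>\<omega>. of_bool (X \<omega> \<le> x)) - cdf std_normal_distribution x\<bar>
    \<le> \<Delta> / 2 + (7 * \<epsilon> + 18 * \<alpha> * \<beta>\<^sup>2 + \<beta>)"
proof -
  define \<delta> where "\<delta> = 4 * \<alpha> * \<beta>\<^sup>2"
  have \<delta>: "0 < \<delta>" using pos by (simp add: \<delta>_def)
  define F where "F y = avg \<Omega> (\<lambda>\<omega>. of_bool (X \<omega> \<le> y))" for y
  let ?\<Phi> = "cdf std_normal_distribution"
  \<comment> \<open>Here 1/4 is \<open>\<alpha> * \<beta>\<^sup>2 / \<delta>\<close>, and the
    bracket bounds the probability that \<open>X\<close> falls into an interval of length
    \<open>\<delta> + 3 * \<beta>\<close>.\<close>
  define e where "e = 7 * \<epsilon> + 13 * \<alpha> * \<beta>\<^sup>2 + (1/4) * (2 * \<Delta> + \<delta> + 3 * \<beta>)"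
  have smooth: "\<bar>avg \<Omega> (\<lambda>\<omega>. ramp y \<delta> (X \<omega>)) - (\<integral>u. ramp y \<delta> u \<partial>std_normal_distribution)\<bar> \<le> e" for y
  proof -
    have "avg \<Omega> (\<lambda>\<omega>. of_bool (y - 2 * \<beta> < X \<omega> \<and> X \<omega> \<le> y + \<delta> + \<beta>))
        = F (y + \<delta> + \<beta>) - F (y - 2 * \<beta>)"
      unfolding F_def avg_diff[symmetric] using pos \<delta> by (intro avg_cong) auto
    also have "\<dots> \<le> 2 * \<Delta> + \<delta> + 3 * \<beta>"
      using \<Delta>[of "y + \<delta> + \<beta>"] \<Delta>[of "y - 2 * \<beta>"] pos \<delta>
        cdf_std_normal_diff_le[of "y - 2 * \<beta>" "y + \<delta> + \<beta>"]
      unfolding F_def abs_le_iff by linarith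
    finally have A: "\<alpha> * \<beta>\<^sup>2 / \<delta> * avg \<Omega> (\<lambda>\<omega>. of_bool (y - 2 * \<beta> < X \<omega> \<and> X \<omega> \<le> y + \<delta> + \<beta>))
      \<le> \<alpha> * \<beta>\<^sup>2 / \<delta> * (2 * \<Delta> + \<delta> + 3 * \<beta>)"
      using pos \<delta> by (intro mult_left_mono) auto
    have r: "\<alpha> * \<beta>\<^sup>2 / \<delta> = 1/4" using pos by (simp add: \<delta>_def)
    show ?thesis using stein_coupling_smooth[OF \<delta>, of y] A unfolding e_def r by linarith
  qed
  have "F x \<le> avg \<Omega> (\<lambda>\<omega>. ramp x \<delta> (X \<omega>))"
    unfolding F_def by (intro avg_mono) (auto simp: ramp_eq_1 \<delta> ramp_bounds)
  then have "F x \<le> ?\<Phi> x + \<delta> + e"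
    using smooth[of x] integral_ramp_bounds(2)[OF \<delta>, of x] cdf_std_normal_diff_le[of x "x + \<delta>"] \<delta>
    unfolding abs_le_iff by linarith
  moreover have "avg \<Omega> (\<lambda>\<omega>. ramp (x - \<delta>) \<delta> (X \<omega>)) \<le> F x"
    unfolding F_def by (intro avg_mono) (auto simp: ramp_eq_0 \<delta> ramp_bounds)
  then have "?\<Phi> x - \<delta> - e \<le> F x"
    using smooth[of "x - \<delta>"] integral_ramp_bounds(1)[OF \<delta>, of "x - \<delta>"]
      cdf_std_normal_diff_le[of "x - \<delta>" x] \<delta>
    unfolding abs_le_iff by linarith
  \<comment> \<open>18 = 4 + 13 + 1, where 4 is the shift by \<open>\<delta>\<close> and 1 is
    \<open>\<delta> / 4\<close>; the term \<open>3 * \<beta> / 4\<close> is rounded up to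
    \<open>\<beta>\<close>.\<close>
  moreover have "\<delta> + e \<le> \<Delta> / 2 + (7 * \<epsilon> + 18 * \<alpha> * \<beta>\<^sup>2 + \<beta>)"
    using pos unfolding e_def \<delta>_def by (simp add: algebra_simps)
  ultimately show ?thesis unfolding F_def abs_le_iff by linarith
qed

text \<open>The bootstrap is applied with \<Delta> equal to the supremum itself. Moving half of it
  to the left doubles the constants; this requires the supremum to be that of a bounded set, hence
  \<open>bdd\<close>.\<close>

lemma stein_coupling_kolmogorov:
  "(SUP x. \<bar>avg \<Omega> (\<lambda>\<omega>. of_bool (X \<omega> \<le> x)) - cdf std_normal_distribution x\<bar>)
    \<le> 14 * \<epsilon> + 36 * \<alpha> * \<beta>\<^sup>2 + 2 * \<beta>" (is "(SUP x. ?d x) \<le> _")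
proof -
  have bdd: "bdd_above (range ?d)"
  proof (rule bdd_aboveI2)
    fix x
    have "avg \<Omega> (\<lambda>\<omega>. of_bool (X \<omega> \<le> x)) \<le> avg \<Omega> (\<lambda>_. 1)" by (intro avg_mono) auto
    moreover have "0 \<le> avg \<Omega> (\<lambda>\<omega>. of_bool (X \<omega> \<le> x))" by (intro avg_nonneg) auto
    ultimately show "?d x \<le> 1"
      using std_normal.cdf_nonneg[of x] std_normal.cdf_bounded_prob[of x]
      by (simp add: avg_const[OF fin ne] abs_le_iff)
  qed
  have "?d x \<le> (SUP x. ?d x) / 2 + (7 * \<epsilon> + 18 * \<alpha> * \<beta>\<^sup>2 + \<beta>)" for x
    by (rule stein_coupling_bootstrap) (rule cSUP_upper[OF _ bdd], simp)
  then have "(SUP x. ?d x) \<le> (SUP x. ?d x) / 2 + (7 * \<epsilon> + 18 * \<alpha> * \<beta>\<^sup>2 + \<beta>)"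
    by (intro cSUP_least) auto
  then show ?thesis by simp
qed

end

section \<open>Variance on orbits of Young subgroups\<close>

lemma avg_Times: "avg (A \<times> B) (\<lambda>(x, y). f x y) = avg A (\<lambda>x. avg B (f x))"
  unfolding avg_def 
  by (simp add: sum.cartesian_product[symmetric] sum_divide_distrib[symmetric] card_cartesian_product mult.commute)

text \<open>Used in two ways: the mean minimises the squared deviation, and, inside an outer
  average, the variance splits into the mean conditional variance and the variance of the
  conditional mean.\<close>

lemma avg_square_diff:
  assumes "finite A" "A \<noteq> {}"
  shows "avg A (\<lambda>x. (f x - m)\<^sup>2) = avg A (\<lambda>x. (f x - avg A f)\<^sup>2) + (avg A f - m)\<^sup>2"
proof -
  have "(f x - m)\<^sup>2 = (f x - avg A f)\<^sup>2 + (2 * (avg A f - m) * (f x - avg A f) + (avg A f - m)\<^sup>2)" for x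
    by (simp add: power2_eq_square algebra_simps)
  then have "avg A (\<lambda>x. (f x - m)\<^sup>2) = avg A (\<lambda>x. (f x - avg A f)\<^sup>2) +
      (2 * (avg A f - m) * (avg A f - avg A f) + (avg A f - m)\<^sup>2)"
    by (simp only: avg_add avg_cmult avg_diff avg_const[OF assms])
  then show ?thesis by simp
qed

section \<open>Young subgroups and their Poincare inequality\<close>

hide_const (open) Finite_Cartesian_Product.transpose

text \<open>A colouring takes the place of blocks, so that dropping an element from \<open>X\<close>
  leaves a subgroup of the same form and induction on \<open>X\<close> is possible.\<close>

definition young :: "'a set \<Rightarrow> ('a \<Rightarrow> 'b) \<Rightarrow> ('a \<Rightarrow> 'a) set" where
  "young X c = {a. a permutes X \<and> (\<forall>x. c (a x) = c x)}"

lemma finite_young: "finite X \<Longrightarrow> finite (young X c)"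
  unfolding young_def using finite_permutations[of X] by (rule finite_subset[rotated]) auto

lemma id_in_young: "id \<in> young X c"
  by (simp add: young_def permutes_id)

lemma young_comp: "a \<in> young X c \<Longrightarrow> b \<in> young X c \<Longrightarrow> a \<circ> b \<in> young X c"
  by (auto simp: young_def permutes_compose)

lemma young_inv: "a \<in> young X c \<Longrightarrow> inv a \<in> young X c"
  unfolding young_def by (auto simp: permutes_inv dest: permutes_inverses(1)) (metis permutes_inverses(1))

lemma young_transpose:
  "x \<in> X \<Longrightarrow> y \<in> X \<Longrightarrow> c x = c y \<Longrightarrow> transpose x y \<in> young X c"
  by (auto simp: young_def permutes_swap_id Transposition.transpose_def)

lemma young_left_translation:
  assumes "a \<in> young X c"
  shows "bij_betw (\<lambda>b. a \<circ> b) (young X c) (young X c)"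
proof (rule bij_betw_byWitness[where f'="\<lambda>b. inv a \<circ> b"])
  have "a permutes X" using assms by (simp add: young_def)
  then show "\<forall>b\<in>young X c. inv a \<circ> (a \<circ> b) = b" "\<forall>b\<in>young X c. a \<circ> (inv a \<circ> b) = b"
    by (simp_all add: o_assoc permutes_inv_o)
qed (auto intro!: young_comp assms young_inv)

lemma young_right_translation:
  assumes "a \<in> young X c"
  shows "bij_betw (\<lambda>b. b \<circ> a) (young X c) (young X c)"
proof (rule bij_betw_byWitness[where f'="\<lambda>b. b \<circ> inv a"])
  have "a permutes X" using assms by (simp add: young_def)
  then show "\<forall>b\<in>young X c. b \<circ> a \<circ> inv a = b" "\<forall>b\<in>young X c. b \<circ> inv a \<circ> a = b"
    by (simp_all add: o_assoc[symmetric] permutes_inv_o)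
qed (auto intro!: young_comp assms young_inv)

text \<open>One step of a random shuffle: the image \<open>y\<close> of \<open>x\<close> is any
  element of its colour, and \<open>a\<close> arranges the rest. The inverse sends \<open>p\<close>
  to \<open>p x\<close> and \<open>transpose x (p x) \<circ> p\<close>.\<close>

lemma young_insert:
  assumes x: "x \<notin> X"
  shows "bij_betw (\<lambda>(y, a). transpose x y \<circ> a) ({y \<in> insert x X. c y = c x} \<times> young X c)
    (young (insert x X) c)"
  unfolding bij_betw_def
proof
  have fix_x: "a x = x" if "a \<in> young X c" for a
    using that x by (auto simp: young_def permutes_not_in)
  show "inj_on (\<lambda>(y, a). transpose x y \<circ> a) ({y \<in> insert x X. c y = c x} \<times> young X c)"
  proof (rule inj_onI, clarsimp)
    fix y a z b
    assume a: "a \<in> young X c" and b: "b \<in> young X c"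
      and eq: "transpose x y \<circ> a = transpose x z \<circ> b"
    have "y = z" using fun_cong[OF eq, of x] fix_x[OF a] fix_x[OF b] by simp
    moreover have "a = b"
    proof
      fix u show "a u = b u"
        using fun_cong[OF eq, of u] \<open>y = z\<close> by (metis comp_apply transpose_involutory)
    qed
    ultimately show "y = z \<and> a = b" by simp
  qed
  show "(\<lambda>(y, a). transpose x y \<circ> a) ` ({y \<in> insert x X. c y = c x} \<times> young X c) =
    young (insert x X) c"
  proof (intro equalityI subsetI)
    fix p assume "p \<in> (\<lambda>(y, a). transpose x y \<circ> a) ` ({y \<in> insert x X. c y = c x} \<times> young X c)"
    then obtain y a where y: "y \<in> insert x X" "c y = c x" and a: "a \<in> young X c"
      and p: "p = transpose x y \<circ> a" by auto
    have "a \<in> young (insert x X) c" using a by (auto simp: young_def intro: permutes_subset)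
    then show "p \<in> young (insert x X) c"
      unfolding p using y by (intro young_comp young_transpose) auto
  next
    fix p assume p: "p \<in> young (insert x X) c"
    then have perm: "p permutes insert x X" and c: "\<And>z. c (p z) = c z" by (auto simp: young_def)
    have px: "p x \<in> insert x X" using permutes_in_image[OF perm, of x] by simp
    have "transpose x (p x) \<in> young (insert x X) c" using px c by (intro young_transpose) auto
    then have "transpose x (p x) \<circ> p \<in> young (insert x X) c" using p by (rule young_comp)
    moreover have "transpose x (p x) \<circ> p permutes X" by (rule permutes_insert_lemma[OF perm])
    ultimately have "transpose x (p x) \<circ> p \<in> young X c" by (simp add: young_def)
    then show "p \<in> (\<lambda>(y, a). transpose x y \<circ> a) ` ({y \<in> insert x X. c y = c x} \<times> young X c)"
      using px c by (intro image_eqI[of _ _ "(p x, transpose x (p x) \<circ> p)"]) (simp_all add: o_assoc)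
  qed
qed

lemma transpose_conjugate: "transpose x y (transpose u v z) = 
    transpose (transpose x y u) (transpose x y v) (transpose x y z)"
  by (auto simp: Transposition.transpose_def)

text \<open>Induction by conditioning on the image \<open>y\<close> of the new element. The
  conditional variance is bounded by the induction hypothesis, and the conditional means lie within
  \<open>L\<close> of a common value, so each element contributes \<open>L\<^sup>2\<close>.\<close>

lemma young_variance_le:
  fixes F :: "('a \<Rightarrow> 'a) \<Rightarrow> real"
  assumes "finite X"
    and "\<And>a u v. a \<in> young X c \<Longrightarrow> u \<in> X \<Longrightarrow> v \<in> X \<Longrightarrow> c u = c v \<Longrightarrow>
      \<bar>F (transpose u v \<circ> a) - F a\<bar> \<le> L"
  shows "avg (young X c) (\<lambda>a. (F a - avg (young X c) F)\<^sup>2) \<le> L\<^sup>2 * real (card X)"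
  using assms
proof (induction X arbitrary: F rule: finite_induct)
  case empty
  have "young {} c = {id}" by (auto simp: young_def)
  then show ?case by (simp add: avg_def)
next
  case (insert x X)
  let ?A = "young X c" and ?A' = "young (insert x X) c" and ?Y = "{y \<in> insert x X. c y = c x}"
  have finA: "finite ?A" "finite ?A'" and finY: "finite ?Y"
    using insert.hyps by (auto intro: finite_young)
  have neA: "?A \<noteq> {}" "?A' \<noteq> {}" and neY: "?Y \<noteq> {}" using id_in_young by auto
  have sub: "a \<in> ?A'" if "a \<in> ?A" for a
    using that by (auto simp: young_def intro: permutes_subset)
  define F' where "F' y a = F (transpose x y \<circ> a)" for y a
  \<comment> \<open>The conditional mean for \<open>y = x\<close>, since
    \<open>transpose x x\<close> is the identity; the other conditional means are compared with
    it.\<close>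
  define m where "m = avg ?A F"
  have IH: "avg ?A (\<lambda>a. (F' y a - avg ?A (F' y))\<^sup>2) \<le> L\<^sup>2 * real (card X)" if y: "y \<in> ?Y" for y
  proof (rule insert.IH)
    fix a u v assume a: "a \<in> ?A" and uv: "u \<in> X" "v \<in> X" "c u = c v"
    have t: "transpose x y \<in> ?A'" using y by (intro young_transpose) auto
    then have tt: "c (transpose x y z) = c z" "transpose x y z \<in> insert x X \<longleftrightarrow> z \<in> insert x X" for z
      using permutes_in_image[of "transpose x y" "insert x X" z] unfolding young_def by auto
    \<comment> \<open>A conjugate of a colour-preserving transposition is again one, which carries
      the hypothesis over from \<open>F\<close> to \<open>F' y\<close>.\<close>
    have "transpose x y \<circ> (transpose u v \<circ> a) =
        transpose (transpose x y u) (transpose x y v) \<circ> (transpose x y \<circ> a)"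
      by (rule ext) (simp add: transpose_conjugate[of x y u v])
    moreover have "\<bar>F (transpose (transpose x y u) (transpose x y v) \<circ> (transpose x y \<circ> a))
        - F (transpose x y \<circ> a)\<bar> \<le> L"
      using tt uv by (intro insert.prems young_comp[OF t sub[OF a]]) auto
    ultimately show "\<bar>F' y (transpose u v \<circ> a) - F' y a\<bar> \<le> L"
      unfolding F'_def by simp
  qed
  have dev: "\<bar>avg ?A (F' y) - m\<bar> \<le> L" if y: "y \<in> ?Y" for y
  proof -
    have "\<bar>avg ?A (F' y) - m\<bar> \<le> avg ?A (\<lambda>a. \<bar>F' y a - F a\<bar>)"
      unfolding m_def avg_diff[symmetric] by (rule avg_abs)
    also have "\<dots> \<le> avg ?A (\<lambda>_. L)"
      unfolding F'_def using y sub by (intro avg_mono insert.prems) auto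
    finally show ?thesis using finA neA by (simp add: avg_const)
  qed
  have "avg ?A' (\<lambda>a. (F a - avg ?A' F)\<^sup>2) \<le> avg ?A' (\<lambda>a. (F a - m)\<^sup>2)"
    using avg_square_diff[OF finA(2) neA(2), of F m] by simp
  also have "\<dots> = avg (?Y \<times> ?A) (\<lambda>(y, a). (F' y a - m)\<^sup>2)"
    unfolding avg_bij[OF young_insert[OF insert.hyps(2), of c], symmetric] F'_def
    by (rule avg_cong) auto
  also have "\<dots> = avg ?Y (\<lambda>y. avg ?A (\<lambda>a. (F' y a - avg ?A (F' y))\<^sup>2) + (avg ?A (F' y) - m)\<^sup>2)"
    unfolding avg_Times by (intro avg_cong avg_square_diff finA neA)
  also have "\<dots> \<le> avg ?Y (\<lambda>_. L\<^sup>2 * real (card X) + L\<^sup>2)"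
    using abs_le_square_iff[THEN iffD1, OF order_trans[OF dev abs_ge_self]]
    by (intro avg_mono add_mono IH) auto
  also have "\<dots> = L\<^sup>2 * real (card (insert x X))"
    using insert.hyps finY neY by (subst avg_const) (auto simp: algebra_simps)
  finally show ?case .
qed

section \<open>Double cosets of Young subgroups\<close>

context
  fixes X :: "'a set" and r :: "'a \<Rightarrow> 'b" and c :: "'a \<Rightarrow> 'c" and s :: "'a \<Rightarrow> 'a"
    and D :: "('a \<Rightarrow> 'a) set"
  assumes fin: "finite X" and s: "s permutes X"
    and D_def: "D = {b \<circ> s \<circ> a | a b. a \<in> young X r \<and> b \<in> young X c}"
begin

lemma young_orbit_permutes: "t \<in> D \<Longrightarrow> t permutes X"
  unfolding D_def young_def by (auto intro!: permutes_compose s)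

lemma finite_young_orbit: "finite D"
  by (rule finite_subset[OF _ finite_permutations[OF fin]]) (auto intro: young_orbit_permutes)

lemma base_in_young_orbit: "s \<in> D"
  unfolding D_def by (intro CollectI exI[of _ id]) (simp add: id_in_young)

lemma young_orbit_nonempty: "D \<noteq> {}"
  using base_in_young_orbit by auto

lemma young_orbit_action:
  assumes "a \<in> young X r" "b \<in> young X c" "t \<in> D"
  shows "b \<circ> t \<circ> a \<in> D"
proof -
  obtain a' b' where t: "t = b' \<circ> s \<circ> a'" "a' \<in> young X r" "b' \<in> young X c"
    using assms(3) unfolding D_def by blast
  have "b \<circ> t \<circ> a = (b \<circ> b') \<circ> s \<circ> (a' \<circ> a)" by (simp add: t o_assoc)
  moreover have "b \<circ> b' \<in> young X c" "a' \<circ> a \<in> young X r"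
    by (intro young_comp t assms)+
  ultimately show ?thesis unfolding D_def by blast
qed

lemma young_orbit_action_bij:
  assumes a: "a \<in> young X r" and b: "b \<in> young X c"
  shows "bij_betw (\<lambda>t. b \<circ> t \<circ> a) D D"
proof (rule bij_betw_byWitness[where f'="\<lambda>t. inv b \<circ> t \<circ> inv a"])
  have ab: "a permutes X" "b permutes X" using a b by (auto simp: young_def)
  show "\<forall>t\<in>D. inv b \<circ> (b \<circ> t \<circ> a) \<circ> inv a = t" "\<forall>t\<in>D. b \<circ> (inv b \<circ> t \<circ> inv a) \<circ> a = t"
    using ab by (auto simp: fun_eq_iff permutes_inverses)
qed (auto intro!: young_orbit_action a b young_inv)

text \<open>The map from pairs (a, b) to the double coset need not be injective. But each pair
  permutes \<open>D\<close>, so averaging over pairs and over \<open>D\<close> together gives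
  \<open>avg D F\<close>, and by translation in the groups the average over pairs does not depend on
  the starting point.\<close>

lemma avg_young_orbit:
  assumes t: "t \<in> D"
  shows "avg D F = avg (young X c) (\<lambda>b. avg (young X r) (\<lambda>a. F (b \<circ> t \<circ> a)))"
proof -
  let ?A = "young X r" and ?B = "young X c"
  have const: "avg ?B (\<lambda>b. avg ?A (\<lambda>a. F (b \<circ> t \<circ> a))) = avg ?B (\<lambda>b. avg ?A (\<lambda>a. F (b \<circ> s \<circ> a)))"
    if "t \<in> D" for t
  proof -
    obtain a' b' where t: "t = b' \<circ> s \<circ> a'" "a' \<in> ?A" "b' \<in> ?B"
      using \<open>t \<in> D\<close> unfolding D_def by blast
    have "avg ?B (\<lambda>b. avg ?A (\<lambda>a. F (b \<circ> t \<circ> a))) =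
        avg ?B (\<lambda>b. (\<lambda>b. avg ?A (\<lambda>a. F (b \<circ> s \<circ> (a' \<circ> a)))) (b \<circ> b'))"
      by (simp add: t o_assoc)
    also have "\<dots> = avg ?B (\<lambda>b. avg ?A (\<lambda>a. F (b \<circ> s \<circ> (a' \<circ> a))))"
      by (rule avg_bij[OF young_right_translation[OF t(3)]])
    also have "\<dots> = avg ?B (\<lambda>b. avg ?A (\<lambda>a. F (b \<circ> s \<circ> a)))"
      by (rule arg_cong[where f="avg ?B"], rule ext)
        (rule avg_bij[OF young_left_translation[OF t(2)]])
    finally show ?thesis .
  qed
  have finAB: "finite ?A" "finite ?B" "?A \<noteq> {}" "?B \<noteq> {}"
    using finite_young[OF fin] id_in_young by blast+
  have "avg D F = avg ?B (\<lambda>b. avg ?A (\<lambda>a. avg D F))"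
    by (simp add: avg_const finAB)
  also have "\<dots> = avg ?B (\<lambda>b. avg ?A (\<lambda>a. avg D (\<lambda>t. F (b \<circ> t \<circ> a))))"
    by (intro avg_cong avg_bij[symmetric] young_orbit_action_bij)
  also have "\<dots> = avg D (\<lambda>t. avg ?B (\<lambda>b. avg ?A (\<lambda>a. F (b \<circ> t \<circ> a))))"
    by (subst avg_swap[of D]) (intro avg_cong avg_swap)
  also have "\<dots> = avg D (\<lambda>_. avg ?B (\<lambda>b. avg ?A (\<lambda>a. F (b \<circ> t \<circ> a))))"
    by (rule avg_cong, rule trans[OF const const[OF t, symmetric]])
  also have "\<dots> = avg ?B (\<lambda>b. avg ?A (\<lambda>a. F (b \<circ> t \<circ> a)))"
    by (rule avg_const[OF finite_young_orbit young_orbit_nonempty])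
  finally show ?thesis .
qed

text \<open>Condition on \<open>b\<close>: the conditional variance concerns \<open>a\<close>, the
  variance of the conditional mean concerns \<open>b\<close>, whence the factor 2. On either side,
  composing with a transposition alters the permutation at two positions only.\<close>

lemma young_orbit_variance_le:
  assumes lip: "\<And>t t' x y. t \<in> D \<Longrightarrow> t' \<in> D \<Longrightarrow> x \<in> X \<Longrightarrow> y \<in> X \<Longrightarrow>
    (\<And>z. z \<noteq> x \<Longrightarrow> z \<noteq> y \<Longrightarrow> t z = t' z) \<Longrightarrow> \<bar>F t - F t'\<bar> \<le> L"
  shows "avg D (\<lambda>t. (F t - avg D F)\<^sup>2) \<le> 2 * L\<^sup>2 * real (card X)"
proof -
  let ?A = "young X r" and ?B = "young X c"
  have finAB: "finite ?A" "finite ?B" "?A \<noteq> {}" "?B \<noteq> {}"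
    using finite_young[OF fin] id_in_young by blast+
  note sD = base_in_young_orbit
  define M where "M b = avg ?A (\<lambda>a. F (b \<circ> s \<circ> a))" for b
  have in_D: "b \<circ> s \<circ> a \<in> D" if "a \<in> ?A" "b \<in> ?B" for a b
    using young_orbit_action[OF that sD] .
  have 1: "avg ?A (\<lambda>a. (F (b \<circ> s \<circ> a) - M b)\<^sup>2) \<le> L\<^sup>2 * real (card X)" if b: "b \<in> ?B" for b
    unfolding M_def
  proof (rule young_variance_le[OF fin])
    fix a u v assume a: "a \<in> ?A" and uv: "u \<in> X" "v \<in> X" "r u = r v"
    have ap: "a permutes X" using a by (simp add: young_def)
    have t: "transpose u v \<circ> a \<in> ?A" by (intro young_comp young_transpose uv a)
    show "\<bar>F (b \<circ> s \<circ> (transpose u v \<circ> a)) - F (b \<circ> s \<circ> a)\<bar> \<le> L"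
    proof (rule lip[OF in_D[OF t b] in_D[OF a b], of "inv a u" "inv a v"])
      show "inv a u \<in> X" "inv a v \<in> X"
        using uv permutes_in_image[OF permutes_inv[OF ap]] by auto
      fix z assume "z \<noteq> inv a u" "z \<noteq> inv a v"
      then have "a z \<noteq> u" "a z \<noteq> v" using permutes_inverses(2)[OF ap] by auto
      then show "(b \<circ> s \<circ> (transpose u v \<circ> a)) z = (b \<circ> s \<circ> a) z" by simp
    qed
  qed
  have 2: "avg ?B (\<lambda>b. (M b - avg ?B M)\<^sup>2) \<le> L\<^sup>2 * real (card X)"
  proof (rule young_variance_le[OF fin])
    fix b u v assume b: "b \<in> ?B" and uv: "u \<in> X" "v \<in> X" "c u = c v"
    have t: "transpose u v \<circ> b \<in> ?B" by (intro young_comp young_transpose uv b)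
    have *: "\<bar>F (transpose u v \<circ> b \<circ> s \<circ> a) - F (b \<circ> s \<circ> a)\<bar> \<le> L" if a: "a \<in> ?A" for a
    proof -
      let ?t = "b \<circ> s \<circ> a"
      have tp: "?t permutes X" by (rule young_orbit_permutes[OF in_D[OF a b]])
      show ?thesis
      proof (rule lip[OF in_D[OF a t] in_D[OF a b], of "inv ?t u" "inv ?t v"])
        show "inv ?t u \<in> X" "inv ?t v \<in> X"
          using uv permutes_in_image[OF permutes_inv[OF tp]] by auto
        fix z assume "z \<noteq> inv ?t u" "z \<noteq> inv ?t v"
        then have "?t z \<noteq> u" "?t z \<noteq> v" using permutes_inverses(2)[OF tp] by auto
        then show "(transpose u v \<circ> b \<circ> s \<circ> a) z = ?t z" by simp
      qed
    qed
    have "\<bar>M (transpose u v \<circ> b) - M b\<bar> \<le>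
        avg ?A (\<lambda>a. \<bar>F (transpose u v \<circ> b \<circ> s \<circ> a) - F (b \<circ> s \<circ> a)\<bar>)"
      unfolding M_def avg_diff[symmetric] by (rule avg_abs)
    also have "\<dots> \<le> avg ?A (\<lambda>_. L)" by (intro avg_mono *)
    finally show "\<bar>M (transpose u v \<circ> b) - M b\<bar> \<le> L" using finAB by (simp add: avg_const)
  qed
  define m where "m = avg D F"
  have m: "m = avg ?B M" unfolding m_def M_def by (rule avg_young_orbit[OF sD])
  have "avg D (\<lambda>t. (F t - m)\<^sup>2) = avg ?B (\<lambda>b. avg ?A (\<lambda>a. (F (b \<circ> s \<circ> a) - m)\<^sup>2))"
    by (rule avg_young_orbit[OF sD])
  also have "\<dots> = avg ?B (\<lambda>b. avg ?A (\<lambda>a. (F (b \<circ> s \<circ> a) - M b)\<^sup>2) + (M b - m)\<^sup>2)"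
    unfolding M_def by (intro avg_cong avg_square_diff finAB)
  also have "\<dots> \<le> avg ?B (\<lambda>b. L\<^sup>2 * real (card X) + (M b - m)\<^sup>2)"
    by (intro avg_mono add_right_mono 1)
  also have "\<dots> \<le> L\<^sup>2 * real (card X) + L\<^sup>2 * real (card X)"
    using 2 unfolding avg_add m by (simp add: avg_const finAB mult.commute)
  finally show ?thesis by (simp add: m_def mult_ac)
qed

end

section \<open>The Stein coupling for descents\<close>

definition close_pairs :: "nat \<Rightarrow> nat \<Rightarrow> (nat \<times> nat) set" where
  "close_pairs d n = {(p, q). p \<in> {1..n} \<and> q \<in> {1..n} \<and> p < q \<and> q \<le> p + d}"

definition inv_at :: "nat \<Rightarrow> nat \<Rightarrow> (nat \<Rightarrow> nat) \<Rightarrow> real" where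
  "inv_at p q t = of_bool (t p > t q)"

lemma finite_close_pairs: "finite (close_pairs d n)"
  by (rule finite_subset[of _ "{1..n} \<times> {1..n}"]) (auto simp: close_pairs_def)

lemma des_eq_sum: "real (des d n t) = (\<Sum>(p, q)\<in>close_pairs d n. inv_at p q t)"
proof -
  have "{(i, j). i \<in> {1..n} \<and> j \<in> {1..n} \<and> i < j \<and> j \<le> i + d \<and> t i > t j} =
      {e \<in> close_pairs d n. t (fst e) > t (snd e)}"
    by (auto simp: close_pairs_def)
  then have "real (des d n t) = (\<Sum>e\<in>close_pairs d n. of_bool (t (fst e) > t (snd e)))"
    unfolding des_def using finite_close_pairs[of d n]
    by (simp add: sum.If_cases of_bool_def Int_def conj_commute)
  then show ?thesis by (simp add: inv_at_def case_prod_beta)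
qed

lemma card_close_pairs_fst: "card {e \<in> close_pairs d n. fst e \<in> Z} \<le> card Z * d" if "finite Z"
proof -
  have "{e \<in> close_pairs d n. fst e \<in> Z} \<subseteq> Sigma Z (\<lambda>p. {p<..p + d})"
    by (auto simp: close_pairs_def)
  then have "card {e \<in> close_pairs d n. fst e \<in> Z} \<le> card (Sigma Z (\<lambda>p. {p<..p + d}))"
    using that by (intro card_mono) auto
  then show ?thesis using that by simp
qed

lemma card_close_pairs_snd: "card {e \<in> close_pairs d n. snd e \<in> Z} \<le> card Z * d" if "finite Z"
proof -
  have "{e \<in> close_pairs d n. snd e \<in> Z} \<subseteq> (\<lambda>(q, p). (p, q)) ` Sigma Z (\<lambda>q. {q - d..<q})"
    by (force simp: close_pairs_def image_iff)
  then have "card {e \<in> close_pairs d n. snd e \<in> Z} \<le> card (Sigma Z (\<lambda>q. {q - d..<q}))"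
    using that by (intro order_trans[OF card_mono card_image_le]) auto
  also have "\<dots> \<le> card Z * d"
    using that sum_bounded_above[of Z "\<lambda>q. q - (q - d)" d] by simp
  finally show ?thesis .
qed

lemma card_close_pairs: "card (close_pairs d n) \<le> n * d"
proof -
  have "{e \<in> close_pairs d n. fst e \<in> {1..n}} = close_pairs d n"
    by (auto simp: close_pairs_def)
  then show ?thesis using card_close_pairs_fst[of "{1..n}" d n] by simp
qed

text \<open>Only pairs meeting \<open>Z\<close> can change, and a position is the left end of at
  most \<open>d\<close> pairs and the right end of at most \<open>d\<close>.\<close>

lemma des_diff_le:
  assumes "finite Z" and eq: "\<And>z. z \<notin> Z \<Longrightarrow> t z = u z"
  shows "\<bar>real (des d n t) - real (des d n u)\<bar> \<le> 2 * real d * real (card Z)"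
proof -
  let ?E = "close_pairs d n"
  let ?B = "{e \<in> ?E. fst e \<in> Z} \<union> {e \<in> ?E. snd e \<in> Z}"
  have "real (des d n t) - real (des d n u) = (\<Sum>(p, q)\<in>?E. inv_at p q t - inv_at p q u)"
    unfolding des_eq_sum by (simp add: sum_subtractf case_prod_beta)
  also have "\<dots> = (\<Sum>(p, q)\<in>?B. inv_at p q t - inv_at p q u)"
  proof (rule sum.mono_neutral_right)
    show "\<forall>e\<in>?E - ?B. (case e of (p, q) \<Rightarrow> inv_at p q t - inv_at p q u) = 0"
    proof
      fix e assume "e \<in> ?E - ?B"
      then have "fst e \<notin> Z" "snd e \<notin> Z" by auto
      then have "t (fst e) = u (fst e)" "t (snd e) = u (snd e)" by (simp_all add: eq)
      then show "(case e of (p, q) \<Rightarrow> inv_at p q t - inv_at p q u) = 0"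
        by (simp add: inv_at_def case_prod_beta)
    qed
  qed (auto simp: finite_close_pairs)
  also have "\<bar>\<dots>\<bar> \<le> (\<Sum>e\<in>?B. 1)"
    by (rule order_trans[OF sum_abs], rule sum_mono) (auto simp: inv_at_def)
  also have "\<dots> = real (card ?B)" by simp
  also have "card ?B \<le> card Z * d + card Z * d"
    using card_close_pairs_fst[OF assms(1), of d n] card_close_pairs_snd[OF assms(1), of d n]
    by (intro order_trans[OF card_Un_le]) simp
  finally show ?thesis by (simp add: algebra_simps)
qed

section \<open>The moves of the coupling\<close>

datatype move = Flip nat nat | Cross nat nat nat nat | Column nat nat nat nat

text \<open>A \<open>Column\<close> move carries \<open>p\<close> and \<open>q\<close> only for its
  weight; what it reads and changes are \<open>x\<close> and \<open>y\<close>.\<close>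

primrec support :: "move \<Rightarrow> nat set" where
  "support (Flip p q) = {p, q}"
| "support (Cross p q x y) = {p, q, x, y}"
| "support (Column p q x y) = {x, y}"

text \<open>Blocks enter as colour classes of positions and of values; monotonicity makes the
  classes consecutive intervals.\<close>

locale descents_on_young_orbit =
  fixes n d :: nat and row col s :: "nat \<Rightarrow> nat" and D :: "(nat \<Rightarrow> nat) set"
  assumes s: "s permutes {1..n}"
    and D_eq: "D = {b \<circ> s \<circ> a | a b. a \<in> young {1..n} row \<and> b \<in> young {1..n} col}"
    and mono_row: "mono_on {1..n} row" and mono_col: "mono_on {1..n} col"
begin

abbreviation "E \<equiv> close_pairs d n"

definition R :: "nat \<Rightarrow> nat set" where "R p = {x \<in> {1..n}. row x = row p}"

definition inner_pairs :: "(nat \<times> nat) set" where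
  "inner_pairs = {(p, q) \<in> E. row p = row q}"

definition cross_pairs :: "(nat \<times> nat) set" where
  "cross_pairs = {(p, q) \<in> E. row p \<noteq> row q}"

definition moves :: "move set" where
  "moves = (\<lambda>(p, q). Flip p q) ` inner_pairs
    \<union> (\<lambda>((p, q), x, y). Cross p q x y) ` Sigma cross_pairs (\<lambda>e. R (fst e) \<times> R (snd e))
    \<union> (\<lambda>((p, q), x, y). Column p q x y) ` Sigma cross_pairs (\<lambda>e. R (fst e) \<times> R (snd e))"

text \<open>The probability of one choice of \<open>x\<close> and \<open>y\<close>, uniform in the
  rows of \<open>p\<close> and \<open>q\<close>.\<close>

definition weight :: "nat \<Rightarrow> nat \<Rightarrow> real" where
  "weight p q = 1 / (real (card (R p)) * real (card (R q)))"

text \<open>The test in the \<open>Column\<close> case keeps the result inside the double coset;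
  when it fails, \<open>G\<close> vanishes as well.\<close>

primrec act :: "move \<Rightarrow> (nat \<Rightarrow> nat) \<Rightarrow> nat \<Rightarrow> nat" where
  "act (Flip p q) t = t \<circ> transpose p q"
| "act (Cross p q x y) t = t \<circ> transpose p x \<circ> transpose q y"
| "act (Column p q x y) t = (if col (t x) = col (t y) then t \<circ> transpose x y else t)"

primrec G :: "move \<Rightarrow> (nat \<Rightarrow> nat) \<Rightarrow> real" where
  "G (Flip p q) t = (inv_at p q t - inv_at q p t) / 2"
| "G (Cross p q x y) t = weight p q * (inv_at p q t - inv_at x y t)"
| "G (Column p q x y) t =
    weight p q * (of_bool (col (t x) = col (t y)) * ((inv_at x y t - inv_at y x t) / 2))"

primrec G_bound :: "move \<Rightarrow> real" where
  "G_bound (Flip p q) = 1 / 2"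
| "G_bound (Cross p q x y) = weight p q"
| "G_bound (Column p q x y) = weight p q / 2"

definition S :: "(nat \<Rightarrow> nat) \<Rightarrow> real" where "S t = real (des d n t)"

lemma finite_R: "finite (R p)" by (simp add: R_def)

lemma finite_pairs: "finite inner_pairs" "finite cross_pairs"
  unfolding inner_pairs_def cross_pairs_def
  by (rule finite_subset[OF _ finite_close_pairs[of d n]], auto)+

section \<open>Sums over moves and their action on the double coset\<close>

lemma sum_moves:
  fixes h :: "move \<Rightarrow> real"
  shows "(\<Sum>k\<in>moves. h k) = (\<Sum>(p, q)\<in>inner_pairs. h (Flip p q)) +
    (\<Sum>(p, q)\<in>cross_pairs. \<Sum>x\<in>R p. \<Sum>y\<in>R q. h (Cross p q x y) + h (Column p q x y))"
proof -
  let ?C = "Sigma cross_pairs (\<lambda>e. R (fst e) \<times> R (snd e))"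
  let ?A1 = "(\<lambda>(p, q). Flip p q) ` inner_pairs"
  let ?A2 = "(\<lambda>((p, q), x, y). Cross p q x y) ` ?C"
  let ?A3 = "(\<lambda>((p, q), x, y). Column p q x y) ` ?C"
  have finC: "finite ?C" using finite_pairs finite_R by auto
  have sigma: "(\<Sum>((p, q), x, y)\<in>?C. f p q x y) =
      (\<Sum>(p, q)\<in>cross_pairs. \<Sum>x\<in>R p. \<Sum>y\<in>R q. f p q x y)" for f :: "_ \<Rightarrow> _ \<Rightarrow> _ \<Rightarrow> _ \<Rightarrow> real"
  proof -
    have "(\<Sum>((p, q), x, y)\<in>?C. f p q x y) = (\<Sum>(e, z)\<in>?C. f (fst e) (snd e) (fst z) (snd z))"
      by (simp add: case_prod_beta)
    also have "\<dots> = (\<Sum>e\<in>cross_pairs. \<Sum>z\<in>R (fst e) \<times> R (snd e). f (fst e) (snd e) (fst z) (snd z))"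
      using finite_pairs finite_R by (subst sum.Sigma) (auto simp: case_prod_beta)
    also have "\<dots> = (\<Sum>e\<in>cross_pairs. \<Sum>x\<in>R (fst e). \<Sum>y\<in>R (snd e). f (fst e) (snd e) x y)"
      by (simp add: sum.cartesian_product case_prod_beta)
    finally show ?thesis by (simp add: case_prod_beta)
  qed
  have "(\<Sum>k\<in>moves. h k) = sum h ?A1 + sum h ?A2 + sum h ?A3"
  proof -
    have fin: "finite ?A1" "finite ?A2" "finite ?A3"
      by (intro finite_imageI finC finite_pairs)+
    have "sum h (?A1 \<union> ?A2 \<union> ?A3) = sum h (?A1 \<union> ?A2) + sum h ?A3"
      by (rule sum.union_disjoint) (use fin in auto)
    also have "sum h (?A1 \<union> ?A2) = sum h ?A1 + sum h ?A2"
      by (rule sum.union_disjoint) (use fin in auto)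
    finally show ?thesis unfolding moves_def .
  qed
  also have "sum h ?A1 = (\<Sum>(p, q)\<in>inner_pairs. h (Flip p q))"
    by (subst sum.reindex) (auto simp: inj_on_def case_prod_beta)
  also have "sum h ?A2 = (\<Sum>((p, q), x, y)\<in>?C. h (Cross p q x y))"
    by (subst sum.reindex) (auto simp: inj_on_def case_prod_beta)
  also have "sum h ?A3 = (\<Sum>((p, q), x, y)\<in>?C. h (Column p q x y))"
    by (subst sum.reindex) (auto simp: inj_on_def case_prod_beta)
  finally show ?thesis
    unfolding sigma by (simp add: sum.distrib case_prod_beta add.assoc)
qed

lemma moves_cases:
  assumes "k \<in> moves"
  obtains (Flip) p q where "k = Flip p q" "p \<in> {1..n}" "q \<in> {1..n}" "p < q" "row p = row q"
  | (Cross) p q x y where "k = Cross p q x y" "p \<in> {1..n}" "q \<in> {1..n}" "x \<in> {1..n}" "y \<in> {1..n}"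
      "row x = row p" "row y = row q" "row p \<noteq> row q"
  | (Column) p q x y where "k = Column p q x y" "p \<in> {1..n}" "q \<in> {1..n}" "x \<in> {1..n}" "y \<in> {1..n}"
      "row x = row p" "row y = row q" "row p \<noteq> row q"
proof -
  from assms consider (flip) p q where "k = Flip p q" "(p, q) \<in> inner_pairs"
    | (cross) p q x y where "k = Cross p q x y" "(p, q) \<in> cross_pairs" "x \<in> R p" "y \<in> R q"
    | (column) p q x y where "k = Column p q x y" "(p, q) \<in> cross_pairs" "x \<in> R p" "y \<in> R q"
    unfolding moves_def by auto
  then show thesis
  proof cases
    case flip
    then show thesis by (intro that(1)[OF flip(1)]) (auto simp: inner_pairs_def close_pairs_def)
  next
    case cross
    then show thesis by (intro that(2)[OF cross(1)]) (auto simp: cross_pairs_def close_pairs_def R_def)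
  next
    case column
    then show thesis by (intro that(3)[OF column(1)]) (auto simp: cross_pairs_def close_pairs_def R_def)
  qed
qed

lemma D_permutes: "t \<in> D \<Longrightarrow> t permutes {1..n}"
  by (rule young_orbit_permutes[OF _ s D_eq]) auto

lemma D_inj: "t \<in> D \<Longrightarrow> t x = t y \<longleftrightarrow> x = y"
  using permutes_inj[OF D_permutes] by (auto dest: injD)

lemma D_in: "t \<in> D \<Longrightarrow> t x \<in> {1..n} \<longleftrightarrow> x \<in> {1..n}"
  using permutes_in_image[OF D_permutes] .

lemma finite_D: "finite D" and D_nonempty: "D \<noteq> {}"
  by (rule finite_young_orbit[OF _ s D_eq] young_orbit_nonempty[OF _ s D_eq], simp)+

lemma D_swap_row:
  assumes "t \<in> D" "x \<in> {1..n}" "y \<in> {1..n}" "row x = row y"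
  shows "t \<circ> transpose x y \<in> D"
  using young_orbit_action[OF _ s D_eq young_transpose[OF assms(2-4)] id_in_young assms(1)] by simp

text \<open>Exchanging two entries amounts to transposing their values on the left, and that
  transposition lies in the column subgroup.\<close>

lemma D_swap_col:
  assumes t: "t \<in> D" "x \<in> {1..n}" "y \<in> {1..n}" "col (t x) = col (t y)"
  shows "t \<circ> transpose x y \<in> D"
proof -
  have "transpose (t x) (t y) \<in> young {1..n} col"
    using assms D_in by (intro young_transpose) auto
  then have "transpose (t x) (t y) \<circ> t \<in> D"
    using young_orbit_action[OF _ s D_eq id_in_young _ t(1)] by simp
  moreover have "transpose (t x) (t y) \<circ> t = t \<circ> transpose x y"
    using D_inj[OF t(1)] by (auto simp: fun_eq_iff Transposition.transpose_def)
  ultimately show ?thesis by simp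
qed

lemma act_in_D:
  assumes "k \<in> moves" and t: "t \<in> D"
  shows "act k t \<in> D"
  using assms(1)
proof (cases rule: moves_cases)
  case (Cross p q x y)
  then show ?thesis using D_swap_row[OF D_swap_row[OF t, of p x], of q y] by simp
next
  case (Column p q x y)
  then show ?thesis using D_swap_col[OF t] t by simp
qed (simp add: D_swap_row t)

text \<open>In a \<open>Cross\<close> move the two transpositions live in different rows and
  commute; a \<open>Column\<close> exchange does not alter the outcome of its own test.\<close>

lemma act_act:
  assumes "k \<in> moves"
  shows "act k (act k t) = t"
  using assms
  by (cases rule: moves_cases) (auto simp: fun_eq_iff Transposition.transpose_def)

lemma G_act:
  assumes "k \<in> moves"
  shows "G k (act k t) = - G k t"
  using assms
proof (cases rule: moves_cases)
  case (Cross p q x y)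
  \<comment> \<open>Positions in different rows are distinct; \<open>p = x\<close> and
    \<open>q = y\<close> remain possible.\<close>
  then have "p \<noteq> q" "p \<noteq> y" "x \<noteq> q" "x \<noteq> y" by auto
  then show ?thesis using Cross
    by (auto simp: inv_at_def Transposition.transpose_def algebra_simps)
next
  case (Column p q x y)
  then have "x \<noteq> y" by auto
  then show ?thesis using Column by (auto simp: inv_at_def)
qed (auto simp: inv_at_def)

lemma G_abs_le: "\<bar>G k t\<bar> \<le> G_bound k"
proof (cases k)
  case (Cross p q x y)
  have "weight p q * \<bar>inv_at p q t - inv_at x y t\<bar> \<le> weight p q * 1"
    by (intro mult_left_mono) (auto simp: inv_at_def weight_def)
  then show ?thesis using Cross by (simp add: abs_mult weight_def)
next
  case (Column p q x y)
  have "weight p q * \<bar>of_bool (col (t x) = col (t y)) * ((inv_at x y t - inv_at y x t) / 2)\<bar> \<le> weight p q * (1 / 2)"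
    by (intro mult_left_mono) (auto simp: inv_at_def weight_def)
  then show ?thesis using Column by (simp add: abs_mult weight_def)
qed (auto simp: inv_at_def)

lemma G_bound_nonneg: "0 \<le> G_bound k"
  by (cases k) (auto simp: weight_def)

text \<open>Reindexing by the involution turns E (G f(S)) into -E (G f(S \<circ> act)); take the
  mean of the two expressions.\<close>

lemma avg_antisym:
  assumes k: "k \<in> moves" shows "avg D (\<lambda>t. G k t * f (S t)) =
    avg D (\<lambda>t. G k t / 2 * (f (S t) - f (S (act k t))))"
proof -
  have bij: "bij_betw (act k) D D"
    by (rule bij_betw_byWitness[where f'="act k"]) (use act_in_D[OF k] act_act[OF k] in auto)
  have "avg D (\<lambda>t. G k t * f (S t)) = avg D (\<lambda>t. G k (act k t) * f (S (act k t)))"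
    by (rule avg_bij[OF bij, symmetric])
  also have "\<dots> = - avg D (\<lambda>t. G k t * f (S (act k t)))"
    using avg_cmult[of D "-1"] by (simp add: G_act[OF k])
  finally have "2 * avg D (\<lambda>t. G k t * f (S t)) =
      avg D (\<lambda>t. G k t * f (S t)) - avg D (\<lambda>t. G k t * f (S (act k t)))" by simp
  also have "\<dots> = avg D (\<lambda>t. 2 * (G k t / 2 * (f (S t) - f (S (act k t)))))"
    unfolding avg_diff[symmetric] by (intro avg_cong) (simp add: algebra_simps)
  finally show ?thesis unfolding avg_cmult by simp
qed

lemma avg_G: "k \<in> moves \<Longrightarrow> avg D (G k) = 0"
  using avg_antisym[of k "\<lambda>_. 1"] by (simp add: avg_def)

section \<open>Decomposition of the centred descent count\<close>

lemma in_R: "p \<in> {1..n} \<Longrightarrow> p \<in> R p" by (simp add: R_def)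

lemma weight_R: "p \<in> {1..n} \<Longrightarrow> q \<in> {1..n} \<Longrightarrow> weight p q * (real (card (R p)) * real (card (R q))) = 1"
  using in_R finite_R by (auto simp: weight_def card_eq_0_iff)

text \<open>Up to the factor \<open>weight p q\<close> this is the mean of \<open>inv_at p q\<close> for positions in different rows; it
  depends on the contingency table only.\<close>

definition table_term :: "nat \<Rightarrow> nat \<Rightarrow> (nat \<Rightarrow> nat) \<Rightarrow> real" where
  "table_term p q t = (\<Sum>x\<in>R p. \<Sum>y\<in>R q.
    of_bool (col (t x) > col (t y)) + of_bool (col (t x) = col (t y)) / 2)"

text \<open>\<open>b\<close> preserves columns, and \<open>a\<close> merely reorders the sums over
  the two rows.\<close>

lemma table_term_const: "t \<in> D \<Longrightarrow> table_term p q t = table_term p q s"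
proof -
  assume "t \<in> D"
  then obtain a b where t: "t = b \<circ> s \<circ> a" and a: "a \<in> young {1..n} row" and b: "b \<in> young {1..n} col"
    unfolding D_eq by blast
  have bij: "bij_betw a (R p) (R p)" for p
  proof -
    have in_R: "b x \<in> R p \<longleftrightarrow> x \<in> R p" if "b \<in> young {1..n} row" for b x
      using that permutes_in_image[of b "{1..n}" x] by (auto simp: young_def R_def)
    have "a permutes {1..n}" using a by (simp add: young_def)
    from permutes_inverses[OF this] show ?thesis
      by (intro bij_betwI[of _ _ _ "inv a"]) (auto simp: in_R[OF a] in_R[OF young_inv[OF a]])
  qed
  have "table_term p q t = (\<Sum>x\<in>R p. \<Sum>y\<in>R q.
      of_bool (col (s (a x)) > col (s (a y))) + of_bool (col (s (a x)) = col (s (a y))) / 2)"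
    unfolding table_term_def t using b by (simp add: young_def)
  also have "\<dots> = table_term p q s"
    unfolding table_term_def
    by (subst sum.reindex_bij_betw[OF bij[of q]],
      subst sum.reindex_bij_betw[OF bij[of p], where g="\<lambda>x. \<Sum>y\<in>R q.
      of_bool (col (s x) > col (s y)) + of_bool (col (s x) = col (s y)) / 2"]) simp
  finally show ?thesis .
qed

text \<open>In different columns the order of values is the order of the columns. In a common
  column, removing the antisymmetric part of the indicator leaves 1/2.\<close>

lemma inv_at_col:
  assumes "t \<in> D" "x \<in> {1..n}" "y \<in> {1..n}" "x \<noteq> y"
  shows "inv_at x y t - of_bool (col (t x) = col (t y)) * ((inv_at x y t - inv_at y x t) / 2)
    = of_bool (col (t x) > col (t y)) + of_bool (col (t x) = col (t y)) / 2"
proof -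
  have "t x \<noteq> t y" using D_inj assms by auto
  have "t x \<in> {1..n}" "t y \<in> {1..n}" using assms by (simp_all only: D_in)
  then have "t x < t y \<Longrightarrow> col (t x) \<le> col (t y)" "t y < t x \<Longrightarrow> col (t y) \<le> col (t x)"
    by (auto intro!: mono_onD[OF mono_col])
  with \<open>t x \<noteq> t y\<close> show ?thesis unfolding inv_at_def
    by (cases "t x < t y") auto
qed

text \<open>Summed over the partners, the weights total 1 and restore \<open>inv_at p q t\<close>;
  the \<open>Column\<close> terms correct \<open>inv_at x y t\<close> to a function of columns,
  whose sum is constant on \<open>D\<close>.\<close>

lemma cross_decomposition:
  assumes e: "(p, q) \<in> cross_pairs" and t: "t \<in> D"
  shows "(\<Sum>x\<in>R p. \<Sum>y\<in>R q. G (Cross p q x y) t + G (Column p q x y) t) =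
    inv_at p q t - weight p q * table_term p q s"
proof -
  have pq: "p \<in> {1..n}" "q \<in> {1..n}" "row p \<noteq> row q"
    using e by (auto simp: cross_pairs_def close_pairs_def)
  have "(\<Sum>x\<in>R p. \<Sum>y\<in>R q. G (Cross p q x y) t + G (Column p q x y) t) =
    (\<Sum>x\<in>R p. \<Sum>y\<in>R q. weight p q * inv_at p q t - weight p q *
      (of_bool (col (t x) > col (t y)) + of_bool (col (t x) = col (t y)) / 2))"
  proof (intro sum.cong refl)
    fix x y assume "x \<in> R p" "y \<in> R q"
    then have "x \<in> {1..n}" "y \<in> {1..n}" "x \<noteq> y" using pq by (auto simp: R_def)
    note * = inv_at_col[OF t this]
    have "G (Cross p q x y) t + G (Column p q x y) t = weight p q * inv_at p q t - weight p q *
      (inv_at x y t - of_bool (col (t x) = col (t y)) * ((inv_at x y t - inv_at y x t) / 2))"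
      by (simp only: G.simps) (simp only: algebra_simps)
    then show "G (Cross p q x y) t + G (Column p q x y) t = weight p q * inv_at p q t - weight p q *
      (of_bool (col (t x) > col (t y)) + of_bool (col (t x) = col (t y)) / 2)"
      unfolding * .
  qed
  also have "\<dots> = weight p q * (real (card (R p)) * real (card (R q))) * inv_at p q t
      - weight p q * table_term p q t"
    unfolding table_term_def by (simp add: sum_subtractf sum_distrib_left mult_ac)
  finally show ?thesis using weight_R[OF pq(1,2)] table_term_const[OF t] by simp
qed

lemma inner_decomposition:
  assumes e: "(p, q) \<in> inner_pairs" and t: "t \<in> D"
  shows "G (Flip p q) t = inv_at p q t - 1 / 2"
proof -
  have "t p \<noteq> t q" using e D_inj[OF t] by (auto simp: inner_pairs_def close_pairs_def)
  then show ?thesis by (auto simp: inv_at_def)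
qed

text \<open>This constant is the mean of \<open>S\<close>: the terms \<open>G k\<close> sum to
  \<open>S t - m\<close> and each has mean 0.\<close>

definition m :: real where
  "m = (\<Sum>(p, q)\<in>inner_pairs. 1 / 2) + (\<Sum>(p, q)\<in>cross_pairs. weight p q * table_term p q s)"

lemma sum_G: assumes t: "t \<in> D" shows "(\<Sum>k\<in>moves. G k t) = S t - m"
proof -
  have E: "E = inner_pairs \<union> cross_pairs" "inner_pairs \<inter> cross_pairs = {}"
    by (auto simp: inner_pairs_def cross_pairs_def)
  have "(\<Sum>k\<in>moves. G k t) = (\<Sum>(p, q)\<in>inner_pairs. inv_at p q t - 1 / 2) +
    (\<Sum>(p, q)\<in>cross_pairs. inv_at p q t - weight p q * table_term p q s)"
    unfolding sum_moves
    by (intro arg_cong2[where f="(+)"] sum.cong refl)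
      (auto simp del: G.simps simp: inner_decomposition t cross_decomposition)
  also have "\<dots> = (\<Sum>(p, q)\<in>E. inv_at p q t) - m"
    unfolding m_def E(1) sum.union_disjoint[OF finite_pairs E(2)]
    by (simp add: sum_subtractf case_prod_beta)
  finally show ?thesis unfolding S_def des_eq_sum .
qed

lemma m_eq: "m = avg D S"
proof -
  have "avg D (\<lambda>t. S t - m) = (\<Sum>k\<in>moves. avg D (G k))"
    unfolding avg_sum[symmetric] by (intro avg_cong) (simp add: sum_G)
  also have "\<dots> = 0" by (simp add: avg_G)
  finally show ?thesis by (simp add: avg_diff avg_const finite_D D_nonempty)
qed

lemma stein_identity:
  "avg D (\<lambda>t. (S t - avg D S) * f (S t)) =
    avg D (\<lambda>t. \<Sum>k\<in>moves. G k t / 2 * (f (S t) - f (S (act k t))))"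
proof -
  have "avg D (\<lambda>t. (S t - avg D S) * f (S t)) = avg D (\<lambda>t. \<Sum>k\<in>moves. G k t * f (S t))"
    unfolding m_eq[symmetric] by (intro avg_cong) (simp add: sum_G[symmetric] sum_distrib_right)
  also have "\<dots> = (\<Sum>k\<in>moves. avg D (\<lambda>t. G k t / 2 * (f (S t) - f (S (act k t)))))"
    unfolding avg_sum by (intro sum.cong refl avg_antisym)
  finally show ?thesis unfolding avg_sum .
qed

lemma sum_G_abs_le: "(\<Sum>k\<in>moves. \<bar>G k t\<bar>) \<le> 2 * real d * real n"
proof -
  have "(\<Sum>k\<in>moves. \<bar>G k t\<bar>) \<le> (\<Sum>k\<in>moves. G_bound k)" by (intro sum_mono G_abs_le)
  also have "\<dots> = (\<Sum>(p, q)\<in>inner_pairs. 1 / 2) +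
    (\<Sum>(p, q)\<in>cross_pairs. 3 / 2 * (weight p q * (real (card (R p)) * real (card (R q)))))"
    unfolding sum_moves by (simp add: algebra_simps)
  \<comment> \<open>The totals 1/2 per inner pair and 3/2 per cross pair are both rounded up to
    2.\<close>
  also have "\<dots> \<le> (\<Sum>e\<in>inner_pairs. 2) + (\<Sum>e\<in>cross_pairs. 2)"
    by (intro add_mono sum_mono) (auto simp: weight_R cross_pairs_def close_pairs_def)
  also have "\<dots> = 2 * real (card inner_pairs + card cross_pairs)" by simp
  also have "card inner_pairs + card cross_pairs = card E"
  proof -
    have "E = inner_pairs \<union> cross_pairs" "inner_pairs \<inter> cross_pairs = {}"
      by (auto simp: inner_pairs_def cross_pairs_def)
    then show ?thesis using card_Un_disjoint[OF finite_pairs] by simp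
  qed
  also have "card E \<le> n * d" by (rule card_close_pairs)
  finally show ?thesis by (simp add: mult_ac)
qed

lemma S_act_le: "\<bar>S t - S (act k t)\<bar> \<le> 8 * real d"
proof -
  have "\<bar>S t - S (act k t)\<bar> \<le> 2 * real d * real (card (support k))"
    unfolding S_def
    by (rule des_diff_le) (cases k; auto simp: Transposition.transpose_def)+
  \<comment> \<open>A \<open>Cross\<close> move has the largest support, of up to four
    positions.\<close>
  also have "\<dots> \<le> 2 * real d * 4"
    by (intro mult_left_mono, cases k) (auto simp: card_insert_if)
  finally show ?thesis by simp
qed

end

section \<open>Variance of the quadratic term\<close>

context descents_on_young_orbit begin

definition H :: "(nat \<Rightarrow> nat) \<Rightarrow> real" where
  "H t = (\<Sum>k\<in>moves. G k t / 2 * (S t - S (act k t)))"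

text \<open>The Stein identity for the identity function. Hence the standardised quadratic term has
  mean 1, and its deviation is controlled by the variance of \<open>H\<close>.\<close>

lemma avg_H: "avg D H = avg D (\<lambda>t. (S t - avg D S)\<^sup>2)"
proof -
  have "avg D (\<lambda>t. (S t - avg D S)\<^sup>2) =
      avg D (\<lambda>t. (S t - avg D S) * S t - avg D S * (S t - avg D S))"
    by (simp add: power2_eq_square algebra_simps)
  also have "\<dots> = avg D H - avg D S * (avg D S - avg D S)"
    unfolding H_def avg_diff avg_cmult stein_identity[of "\<lambda>x. x"]
    by (simp add: avg_const finite_D D_nonempty)
  finally show ?thesis by simp
qed

section \<open>Which moves notice a change at a given position\<close>

definition near :: "nat \<Rightarrow> nat \<Rightarrow> bool" where
  "near x z \<longleftrightarrow> x \<le> z + d \<and> z \<le> x + d"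

definition touches :: "nat \<Rightarrow> move \<Rightarrow> bool" where
  "touches x k \<longleftrightarrow> (\<exists>z\<in>support k. near x z)"

lemma act_outside: "z \<notin> support k \<Longrightarrow> act k t z = t z"
  by (cases k) (auto simp: Transposition.transpose_def)

lemma act_local:
  assumes "\<And>y. y \<in> support k \<Longrightarrow> t y = u y" and "t z = u z"
  shows "act k t z = act k u z"
  using assms by (cases k) (auto simp: Transposition.transpose_def)

lemma G_local:
  assumes "\<And>y. y \<in> support k \<Longrightarrow> t y = u y"
  shows "G k t = G k u"
  using assms by (cases k) (auto simp: inv_at_def)

text \<open>\<open>G k\<close> reads values on the support only. In the difference of the two
  descent counts all pairs missing the support cancel, and the others stay within distance
  \<open>d\<close> of it.\<close>

lemma H_term_local:
  assumes eq: "\<And>z. z \<noteq> x \<Longrightarrow> z \<noteq> y \<Longrightarrow> t z = u z"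
    and "\<not> touches x k" "\<not> touches y k"
  shows "G k t / 2 * (S t - S (act k t)) = G k u / 2 * (S u - S (act k u))"
proof -
  have nbh: "t z = u z" if "z' \<in> support k" "z \<le> z' + d" "z' \<le> z + d" for z z'
    using assms(2,3) that by (intro eq) (auto simp: touches_def near_def)
  have supp: "t z = u z" if "z \<in> support k" for z using that nbh[of z z] by simp
  have "S t - S (act k t) = (\<Sum>(p, q)\<in>E. inv_at p q t - inv_at p q (act k t))"
    unfolding S_def des_eq_sum by (simp add: sum_subtractf case_prod_beta)
  also have "\<dots> = (\<Sum>(p, q)\<in>E. inv_at p q u - inv_at p q (act k u))"
  proof (rule sum.cong[OF refl], clarify)
    fix p q assume e: "(p, q) \<in> E"
    show "inv_at p q t - inv_at p q (act k t) = inv_at p q u - inv_at p q (act k u)"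
    proof (cases "p \<in> support k \<or> q \<in> support k")
      case True
      then have "t p = u p" "t q = u q"
        using e nbh[of p q] nbh[of q p] nbh[of p p] nbh[of q q] by (auto simp: close_pairs_def)
      then show ?thesis
        using act_local[of k t u p] act_local[of k t u q] supp by (simp add: inv_at_def)
    qed (simp add: inv_at_def act_outside)
  qed
  also have "\<dots> = S u - S (act k u)"
    unfolding S_def des_eq_sum by (simp add: sum_subtractf case_prod_beta)
  finally show ?thesis using G_local[of k t u] supp by simp
qed

lemma H_term_abs_le: "\<bar>G k t / 2 * (S t - S (act k t))\<bar> \<le> 4 * real d * G_bound k"
proof -
  have "\<bar>G k t\<bar> * \<bar>S t - S (act k t)\<bar> \<le> G_bound k * (8 * real d)"
    by (intro mult_mono G_abs_le S_act_le G_bound_nonneg) auto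
  then show ?thesis by (simp add: abs_mult mult_ac)
qed

section \<open>Counting the moves near a position\<close>

lemma mono_row_between:
  "p \<in> {1..n} \<Longrightarrow> q \<in> {1..n} \<Longrightarrow> p \<le> z \<Longrightarrow> z \<le> q \<Longrightarrow> row p = row q \<Longrightarrow> row z = row p"
  using mono_onD[OF mono_row, of p z] mono_onD[OF mono_row, of z q] by auto

text \<open>Rows are intervals, so such a pair straddles the last position \<open>b\<close> of the
  row: its left end is among the \<open>d\<close> positions up to \<open>b\<close>, its right end
  among the \<open>d\<close> after it.\<close>

lemma card_row_exits: "card {e \<in> cross_pairs. row (fst e) = i} \<le> d * d"
proof (cases "\<exists>p\<in>{1..n}. row p = i")
  case True
  define b where "b = Max {p \<in> {1..n}. row p = i}"
  have b: "b \<in> {p \<in> {1..n}. row p = i}" unfolding b_def using True by (intro Max_in) auto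
  have b_max: "p \<le> b" if "p \<in> {1..n}" "row p = i" for p
    unfolding b_def using that by (intro Max_ge) auto
  have "{e \<in> cross_pairs. row (fst e) = i} \<subseteq> {b + 1 - d..<b + 1} \<times> {b<..b + d}"
  proof
    fix e assume "e \<in> {e \<in> cross_pairs. row (fst e) = i}"
    then obtain p q where e: "e = (p, q)" and
      pq: "p \<in> {1..n}" "q \<in> {1..n}" "p < q" "q \<le> p + d" "row p \<noteq> row q" "row p = i"
      by (cases e) (auto simp: cross_pairs_def close_pairs_def)
    have "p \<le> b" using b_max pq by auto
    moreover have "b < q" using mono_row_between[of p b q] pq b by fastforce
    ultimately show "e \<in> {b + 1 - d..<b + 1} \<times> {b<..b + d}" using pq e by auto
  qed
  then have "card {e \<in> cross_pairs. row (fst e) = i} \<le> card ({b + 1 - d..<b + 1} \<times> {b<..b + d})"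
    by (intro card_mono) auto
  also have "\<dots> \<le> d * d"
    unfolding card_cartesian_product by (intro mult_le_mono) auto
  finally show ?thesis .
next
  case False
  then have "{e \<in> cross_pairs. row (fst e) = i} = {}"
    by (force simp: cross_pairs_def close_pairs_def)
  then show ?thesis by (metis card.empty zero_le)
qed

lemma card_row_entries: "card {e \<in> cross_pairs. row (snd e) = i} \<le> d * d"
proof (cases "\<exists>p\<in>{1..n}. row p = i")
  case True
  define b where "b = Min {p \<in> {1..n}. row p = i}"
  have b: "b \<in> {p \<in> {1..n}. row p = i}" unfolding b_def using True by (intro Min_in) auto
  have b_min: "b \<le> p" if "p \<in> {1..n}" "row p = i" for p
    unfolding b_def using that by (intro Min_le) auto
  have "{e \<in> cross_pairs. row (snd e) = i} \<subseteq> {b - d..<b} \<times> {b..<b + d}"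
  proof
    fix e assume "e \<in> {e \<in> cross_pairs. row (snd e) = i}"
    then obtain p q where e: "e = (p, q)" and
      pq: "p \<in> {1..n}" "q \<in> {1..n}" "p < q" "q \<le> p + d" "row p \<noteq> row q" "row q = i"
      by (cases e) (auto simp: cross_pairs_def close_pairs_def)
    have "b \<le> q" using b_min pq by auto
    moreover have "p < b" using mono_row_between[of b q p] pq b by fastforce
    ultimately show "e \<in> {b - d..<b} \<times> {b..<b + d}" using pq e by auto
  qed
  then have "card {e \<in> cross_pairs. row (snd e) = i} \<le> card ({b - d..<b} \<times> {b..<b + d})"
    by (intro card_mono) auto
  also have "\<dots> \<le> d * d"
    unfolding card_cartesian_product by (intro mult_le_mono) auto
  finally show ?thesis .
next
  case False
  then have "{e \<in> cross_pairs. row (snd e) = i} = {}"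
    by (force simp: cross_pairs_def close_pairs_def)
  then show ?thesis by (metis card.empty zero_le)
qed

lemma near_set: "finite {z. near x z}" "card {z. near x z} \<le> 2 * d + 1"
proof -
  have sub: "{z. near x z} \<subseteq> {x - d..x + d}" by (auto simp: near_def)
  then show "finite {z. near x z}" by (rule finite_subset) simp
  have "card {z. near x z} \<le> card {x - d..x + d}" using sub by (intro card_mono) auto
  then show "card {z. near x z} \<le> 2 * d + 1" by simp
qed

lemma sum_of_bool_card: "finite A \<Longrightarrow> (\<Sum>e\<in>A. of_bool (P e) :: real) = real (card {e \<in> A. P e})"
  by (simp add: of_bool_def sum.If_cases Int_def)

text \<open>A row has at most \<open>d * d\<close> pairs leading out of it, but its partners \<open>x\<close> range over the whole row; the
  weights compensate for the number of partners, so the bound does not depend on the row lengths.\<close>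

lemma sum_touching_le:
  "(\<Sum>k\<in>moves. of_bool (touches x k) * G_bound k) \<le> 3 * (2 * real d + 1) * (real d + real d * real d)"
proof -
  define N where "N z = (of_bool (near x z) :: real)" for z
  define Z where "Z = {z. near x z}"
  have N: "0 \<le> N z" for z by (simp add: N_def)
  have Z: "finite Z" "real (card Z) \<le> 2 * real d + 1"
    using near_set[of x] by (auto simp: Z_def simp flip: of_nat_Suc)
  have E: "E = inner_pairs \<union> cross_pairs" "inner_pairs \<inter> cross_pairs = {}"
    by (auto simp: inner_pairs_def cross_pairs_def)
  have pos: "real (card (R p)) > 0" if "p \<in> {1..n}" for p
    using in_R[OF that] finite_R by (auto simp: card_gt_0_iff)
  define row_hits where "row_hits p = (\<Sum>z\<in>R p. N z)" for p
  have row_hits_le: "row_hits p \<le> (\<Sum>z\<in>Z. of_bool (row p = row z))" for p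
  proof -
    have "row_hits p = (\<Sum>z\<in>R p \<inter> Z. 1)"
      unfolding row_hits_def N_def Z_def using finite_R by (intro sum.mono_neutral_cong_right) auto
    also have "\<dots> = (\<Sum>z\<in>R p \<inter> Z. of_bool (row p = row z))"
      by (intro sum.cong) (auto simp: R_def)
    also have "\<dots> \<le> (\<Sum>z\<in>Z. of_bool (row p = row z))" using Z by (intro sum_mono2) auto
    finally show ?thesis .
  qed
  have cross: "(\<Sum>u\<in>R p. \<Sum>v\<in>R q. of_bool (touches x (Cross p q u v)) * G_bound (Cross p q u v) +
      of_bool (touches x (Column p q u v)) * G_bound (Column p q u v))
      \<le> 3 / 2 * (N p + N q) + 3 / 2 * (row_hits p + row_hits q)"
    if e: "(p, q) \<in> cross_pairs" for p q
  proof -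
    have pq: "p \<in> {1..n}" "q \<in> {1..n}" using e by (auto simp: cross_pairs_def close_pairs_def)
    let ?w = "weight p q"
    have w: "0 \<le> ?w" by (simp add: weight_def)
    have "of_bool (touches x (Cross p q u v)) * G_bound (Cross p q u v) +
      of_bool (touches x (Column p q u v)) * G_bound (Column p q u v)
      \<le> 3 / 2 * ?w * (N p + N q + N u + N v)" for u v
    proof -
      have 1: "of_bool (touches x (Cross p q u v)) \<le> N p + N q + N u + N v"
        and 2: "of_bool (touches x (Column p q u v)) \<le> N p + N q + N u + N v"
        by (auto simp: touches_def N_def)
      have "of_bool (touches x (Cross p q u v)) * ?w + of_bool (touches x (Column p q u v)) * (?w / 2)
          \<le> (N p + N q + N u + N v) * ?w + (N p + N q + N u + N v) * (?w / 2)"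
        using w by (intro add_mono mult_right_mono 1 2) auto
      also have "\<dots> = 3 / 2 * ?w * (N p + N q + N u + N v)" by (simp add: field_simps)
      finally show ?thesis by simp
    qed
    then have "(\<Sum>u\<in>R p. \<Sum>v\<in>R q. of_bool (touches x (Cross p q u v)) * G_bound (Cross p q u v) +
      of_bool (touches x (Column p q u v)) * G_bound (Column p q u v))
      \<le> (\<Sum>u\<in>R p. \<Sum>v\<in>R q. 3 / 2 * ?w * (N p + N q + N u + N v))"
      by (intro sum_mono)
    also have "\<dots> = 3 / 2 * ?w * (\<Sum>u\<in>R p. \<Sum>v\<in>R q. N p + N q + N u + N v)"
      by (simp only: sum_distrib_left)
    also have "(\<Sum>u\<in>R p. \<Sum>v\<in>R q. N p + N q + N u + N v) =
        real (card (R p)) * (real (card (R q)) * (N p + N q)) + real (card (R q)) * row_hits p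
        + real (card (R p)) * row_hits q"
      unfolding row_hits_def by (simp only: sum.distrib sum_constant sum_distrib_left distrib_left)
    also have "3 / 2 * ?w * \<dots> = 3 / 2 * (?w * (real (card (R p)) * real (card (R q)))) * (N p + N q)
        + 3 / 2 * ((?w * real (card (R q))) * row_hits p + (?w * real (card (R p))) * row_hits q)"
      by (simp add: algebra_simps)
    \<comment> \<open>For \<open>p\<close> and \<open>q\<close> the sum over both partners cancels
      the weight. For hits by a partner only the sum over the other row cancels, leaving the
      reciprocal of a row length, which is at most 1.\<close>
    also have "\<dots> \<le> 3 / 2 * 1 * (N p + N q) + 3 / 2 * (1 * row_hits p + 1 * row_hits q)"
    proof (intro add_mono mult_left_mono mult_right_mono)
      show "?w * real (card (R q)) \<le> 1" "?w * real (card (R p)) \<le> 1"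
        using pos[OF pq(1)] pos[OF pq(2)] by (auto simp: weight_def field_simps)
      show "0 \<le> row_hits p" "0 \<le> row_hits q" unfolding row_hits_def by (simp_all add: sum_nonneg N)
    qed (use weight_R[OF pq] N in auto)
    finally show ?thesis by simp
  qed
  \<comment> \<open>Exchange the sums: each position of \<open>Z\<close> is charged with the at most
    \<open>d * d\<close> pairs leaving, respectively entering, its row.\<close>
  have hits: "(\<Sum>e\<in>cross_pairs. row_hits (f e)) \<le> (2 * real d + 1) * (real d * real d)"
    if "\<And>i. card {e \<in> cross_pairs. row (f e) = i} \<le> d * d" for f
  proof -
    have "(\<Sum>e\<in>cross_pairs. row_hits (f e)) \<le> (\<Sum>e\<in>cross_pairs. \<Sum>z\<in>Z. of_bool (row (f e) = row z))"
      by (intro sum_mono row_hits_le)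
    also have "\<dots> = (\<Sum>z\<in>Z. real (card {e \<in> cross_pairs. row (f e) = row z}))"
      by (subst sum.swap) (simp only: sum_of_bool_card[OF finite_pairs(2)])
    also have "\<dots> \<le> (\<Sum>z\<in>Z. real (d * d))" using that by (intro sum_mono of_nat_mono)
    also have "\<dots> = real (card Z) * (real d * real d)" by simp
    also have "\<dots> \<le> (2 * real d + 1) * (real d * real d)" using Z by (intro mult_right_mono) auto
    finally show ?thesis .
  qed
  have "(\<Sum>k\<in>moves. of_bool (touches x k) * G_bound k) \<le>
      (\<Sum>(p, q)\<in>inner_pairs. 3 / 2 * (N p + N q)) +
      (\<Sum>(p, q)\<in>cross_pairs. 3 / 2 * (N p + N q) + 3 / 2 * (row_hits p + row_hits q))"
    unfolding sum_moves
  proof (rule add_mono; rule sum_mono)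
    fix e show "(case e of (p, q) \<Rightarrow> of_bool (touches x (Flip p q)) * G_bound (Flip p q))
        \<le> (case e of (p, q) \<Rightarrow> 3 / 2 * (N p + N q))"
      by (cases e) (auto simp: touches_def N_def)
  next
    fix e assume "e \<in> cross_pairs"
    then show "(case e of (p, q) \<Rightarrow> \<Sum>u\<in>R p. \<Sum>v\<in>R q.
        of_bool (touches x (Cross p q u v)) * G_bound (Cross p q u v) +
        of_bool (touches x (Column p q u v)) * G_bound (Column p q u v))
      \<le> (case e of (p, q) \<Rightarrow> 3 / 2 * (N p + N q) + 3 / 2 * (row_hits p + row_hits q))"
      by (cases e) (simp only: prod.case cross)
  qed
  also have "\<dots> = 3 / 2 * ((\<Sum>e\<in>E. N (fst e)) + (\<Sum>e\<in>E. N (snd e))) +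
      3 / 2 * ((\<Sum>e\<in>cross_pairs. row_hits (fst e)) + (\<Sum>e\<in>cross_pairs. row_hits (snd e)))"
    unfolding E(1) sum.union_disjoint[OF finite_pairs E(2)]
    unfolding case_prod_beta
    by (simp only: sum.distrib distrib_left sum_distrib_left[symmetric])
  also have "\<dots> \<le> 3 / 2 * ((2 * real d + 1) * real d + (2 * real d + 1) * real d) +
      3 / 2 * ((2 * real d + 1) * (real d * real d) + (2 * real d + 1) * (real d * real d))"
  proof (intro add_mono mult_left_mono hits card_row_exits card_row_entries)
    have Zd: "real (card Z * d) \<le> (2 * real d + 1) * real d"
      using mult_right_mono[OF Z(2), of "real d"] by simp
    have "(\<Sum>e\<in>E. N (fst e)) = real (card {e \<in> E. fst e \<in> Z})"
      unfolding N_def Z_def by (simp only: sum_of_bool_card[OF finite_close_pairs] mem_Collect_eq)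
    also have "\<dots> \<le> real (card Z * d)" by (intro of_nat_mono card_close_pairs_fst Z)
    finally show "(\<Sum>e\<in>E. N (fst e)) \<le> (2 * real d + 1) * real d" using Zd by simp
    have "(\<Sum>e\<in>E. N (snd e)) = real (card {e \<in> E. snd e \<in> Z})"
      unfolding N_def Z_def by (simp only: sum_of_bool_card[OF finite_close_pairs] mem_Collect_eq)
    also have "\<dots> \<le> real (card Z * d)" by (intro of_nat_mono card_close_pairs_snd Z)
    finally show "(\<Sum>e\<in>E. N (snd e)) \<le> (2 * real d + 1) * real d" using Zd by simp
  qed auto
  also have "\<dots> = 3 * (2 * real d + 1) * (real d + real d * real d)" by (simp add: algebra_simps)
  finally show ?thesis .
qed

text \<open>48 = 8 * (3 + 3): a touched term changes by at most twice
  \<open>4 * real d * G_bound k\<close>, and each of the two altered positions contributes the bound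
  of \<open>sum_touching_le\<close>.\<close>

definition L :: real where
  "L = 48 * real d * (2 * real d + 1) * (real d + real d * real d)"

lemma H_lipschitz:
  assumes eq: "\<And>z. z \<noteq> x \<Longrightarrow> z \<noteq> y \<Longrightarrow> t z = u z"
  shows "\<bar>H t - H u\<bar> \<le> L"
proof -
  let ?h = "\<lambda>t k. G k t / 2 * (S t - S (act k t))"
  let ?T = "\<lambda>x. \<Sum>k\<in>moves. of_bool (touches x k) * G_bound k"
  have "\<bar>H t - H u\<bar> \<le> (\<Sum>k\<in>moves. \<bar>?h t k - ?h u k\<bar>)"
    unfolding H_def sum_subtractf[symmetric] by (rule sum_abs)
  also have "\<dots> \<le> (\<Sum>k\<in>moves. 8 * real d * (of_bool (touches x k) * G_bound k + of_bool (touches y k) * G_bound k))"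
  proof (rule sum_mono)
    fix k
    show "\<bar>?h t k - ?h u k\<bar> \<le>
      8 * real d * (of_bool (touches x k) * G_bound k + of_bool (touches y k) * G_bound k)"
    proof (cases "touches x k \<or> touches y k")
      case True
      have "\<bar>?h t k - ?h u k\<bar> \<le> 8 * real d * G_bound k"
        using H_term_abs_le[of k t] H_term_abs_le[of k u] by linarith
      also have "\<dots> \<le> 8 * real d * (of_bool (touches x k) * G_bound k + of_bool (touches y k) * G_bound k)"
        using True G_bound_nonneg[of k] by (intro mult_left_mono) auto
      finally show ?thesis .
    next
      case False
      then show ?thesis using H_term_local[of x y t u k] eq by simp
    qed
  qed
  also have "\<dots> = 8 * real d * (?T x + ?T y)"
    by (simp add: sum_distrib_left[symmetric] sum.distrib)
  also have "\<dots> \<le> 8 * real d * (3 * (2 * real d + 1) * (real d + real d * real d)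
      + 3 * (2 * real d + 1) * (real d + real d * real d))"
    by (intro mult_left_mono add_mono sum_touching_le) auto
  also have "\<dots> = L" unfolding L_def by (simp add: algebra_simps)
  finally show ?thesis .
qed

lemma variance_H_le: "avg D (\<lambda>t. (H t - avg D H)\<^sup>2) \<le> 2 * L\<^sup>2 * real n"
proof -
  have "avg D (\<lambda>t. (H t - avg D H)\<^sup>2) \<le> 2 * L\<^sup>2 * real (card {1..n})"
    by (rule young_orbit_variance_le[OF _ s D_eq]) (auto intro: H_lipschitz)
  then show ?thesis by simp
qed

end

section \<open>Lower bound for the variance of the number of descents\<close>

text \<open>The loss of descents when the neighbours \<open>a\<close> and \<open>b\<close> are
  exchanged, where \<open>x\<close> stands \<open>d\<close> places before \<open>a\<close> and
  \<open>y\<close> stands \<open>d\<close> places after \<open>b\<close>.\<close>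

definition swap_gain :: "nat \<Rightarrow> nat \<Rightarrow> nat \<Rightarrow> nat \<Rightarrow> real" where
  "swap_gain x a b y = (of_bool (a > b) + of_bool (x > a) + of_bool (b > y))
    - (of_bool (b > a) + of_bool (x > b) + of_bool (a > y))"

lemma swap_gain_swap: "swap_gain x b a y = - swap_gain x a b y"
  by (simp add: swap_gain_def)

text \<open>The gain vanishes only if exactly one of \<open>x\<close> and \<open>y\<close> lies between \<open>a\<close> and \<open>b\<close>; exchanging that
  one with its neighbour makes the gain nonzero.\<close>

lemma swap_gain_squares:
  assumes "distinct [x, a, b, y]"
  shows "1 \<le> (swap_gain x a b y)\<^sup>2 + (swap_gain a x b y)\<^sup>2 + (swap_gain x a y b)\<^sup>2"
proof -
  have sq: "1 \<le> (swap_gain x a b y)\<^sup>2" if "swap_gain x a b y \<noteq> 0" for x a b y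
  proof -
    \<comment> \<open>The gain is an integer, so if nonzero it has absolute value at least
      1.\<close>
    have "swap_gain x a b y = of_int ((of_bool (a > b) + of_bool (x > a) + of_bool (b > y))
        - (of_bool (b > a) + of_bool (x > b) + of_bool (a > y)))" (is "_ = of_int ?i")
      by (simp add: swap_gain_def)
    then have "?i \<noteq> 0" using that by (metis of_int_0)
    then have "1 \<le> \<bar>?i\<bar>" by linarith
    then have "1 \<le> \<bar>swap_gain x a b y\<bar>"
      unfolding \<open>swap_gain x a b y = _\<close> by (metis of_int_1_le_iff of_int_abs)
    then show ?thesis by (metis one_le_power power2_abs)
  qed
  have "swap_gain x a b y \<noteq> 0 \<or> swap_gain a x b y \<noteq> 0 \<or> swap_gain x a y b \<noteq> 0"
  proof -
    have "a < b \<or> b < a" "x < a \<or> a < x" "x < b \<or> b < x" "y < a \<or> a < y" "y < b \<or> b < y"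
      using assms by auto
    then show ?thesis by (elim disjE) (simp_all add: swap_gain_def)
  qed
  then show ?thesis
    using sq[of x a b y] sq[of a x b y] sq[of x a y b]
      zero_le_power2[of "swap_gain x a b y"] zero_le_power2[of "swap_gain a x b y"]
      zero_le_power2[of "swap_gain x a y b"] by linarith
qed

context descents_on_young_orbit begin

section \<open>Windows inside a row and the gains of adjacent exchanges\<close>

definition gain :: "nat \<Rightarrow> (nat \<Rightarrow> nat) \<Rightarrow> real" where
  "gain p t = swap_gain (t (p - d)) (t p) (t (p + 1)) (t (p + 1 + d))"

text \<open>Equal rows at both ends put all \<open>2 * d + 2\<close> positions into one row;
  \<open>d < p\<close> makes the subtraction \<open>p - d\<close> exact and its result
  positive.\<close>

definition window :: "nat \<Rightarrow> bool" where
  "window p \<longleftrightarrow> d < p \<and> p + 1 + d \<le> n \<and> row (p - d) = row (p + 1 + d)"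

lemma window_row:
  assumes "window p" "p - d \<le> z" "z \<le> p + 1 + d"
  shows "z \<in> {1..n}" "row z = row (p - d)"
proof -
  show z: "z \<in> {1..n}" using assms by (auto simp: window_def)
  have "p - d \<in> {1..n}" "p + 1 + d \<in> {1..n}" using assms by (auto simp: window_def)
  then have "row (p - d) \<le> row z" "row z \<le> row (p + 1 + d)"
    using mono_onD[OF mono_row _ z assms(2)] mono_onD[OF mono_row z _ assms(3)] by auto
  then show "row z = row (p - d)" using assms by (simp add: window_def)
qed

lemma avg_swap_row:
  assumes "x \<in> {1..n}" "y \<in> {1..n}" "row x = row y"
  shows "avg D (\<lambda>t. F (t \<circ> transpose x y)) = avg D F"
proof (rule avg_bij)
  show "bij_betw (\<lambda>t. t \<circ> transpose x y) D D"
    by (rule bij_betw_byWitness[where f'="\<lambda>t. t \<circ> transpose x y"])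
      (use D_swap_row assms in \<open>auto simp: o_assoc[symmetric]\<close>)
qed

text \<open>The exchange relabels the pairs by \<tau>. \<open>E\<close> and its image differ only in
  the pair \<open>(p, p + 1)\<close> and in the pairs at distance exactly \<open>d\<close> that
  reach outwards, three on each side.\<close>

lemma S_swap_adjacent:
  assumes d: "0 < d" and p: "window p"
  shows "S t - S (t \<circ> transpose p (p + 1)) = gain p t"
proof -
  define \<tau> where "\<tau> = transpose p (p + 1)"
  define E' where "E' = {(u, v). (\<tau> u, \<tau> v) \<in> E}"
  define f where "f e = inv_at (fst e) (snd e) t" for e
  have \<tau>\<tau>: "\<tau> (\<tau> u) = u" for u by (simp add: \<tau>_def)
  have bij: "bij_betw (\<lambda>(u, v). (\<tau> u, \<tau> v)) E E'"
    by (rule bij_betw_byWitness[where f'="\<lambda>(u, v). (\<tau> u, \<tau> v)"]) (auto simp: E'_def \<tau>\<tau>)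
  have finE: "finite E" "finite E'"
    using finite_close_pairs bij_betw_finite[OF bij] by auto
  have "S t = sum f E" unfolding S_def des_eq_sum f_def by (simp add: case_prod_beta)
  moreover have "S (t \<circ> \<tau>) = (\<Sum>e\<in>E. f ((\<lambda>(u, v). (\<tau> u, \<tau> v)) e))"
    unfolding S_def des_eq_sum f_def by (simp add: case_prod_beta inv_at_def)
  then have "S (t \<circ> \<tau>) = sum f E'" by (simp only: sum.reindex_bij_betw[OF bij])
  ultimately have "S t - S (t \<circ> \<tau>) = sum f (E - E') - sum f (E' - E)"
    using sum.Int_Diff[OF finE(1), of f E'] sum.Int_Diff[OF finE(2), of f E] by (simp add: Int_commute)
  also have "E - E' = {(p, p + 1), (p - d, p), (p + 1, p + 1 + d)}"
    using d p unfolding E'_def \<tau>_def close_pairs_def window_def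
    by (auto simp: Transposition.transpose_def split: if_splits)
  also have "E' - E = {(p + 1, p), (p - d, p + 1), (p, p + 1 + d)}"
    using d p unfolding E'_def \<tau>_def close_pairs_def window_def
    by (auto simp: Transposition.transpose_def split: if_splits)
  finally have "S t - S (t \<circ> \<tau>) = sum f {(p, p + 1), (p - d, p), (p + 1, p + 1 + d)}
      - sum f {(p + 1, p), (p - d, p + 1), (p, p + 1 + d)}" .
  moreover have "p - d \<noteq> p" "p - d \<noteq> p + 1" "p + 1 + d \<noteq> p" "p + 1 + d \<noteq> p + 1"
    using d p by (auto simp: window_def)
  ultimately show ?thesis
    by (simp add: f_def inv_at_def gain_def swap_gain_def \<tau>_def)
qed

lemma gain_swap_self:
  assumes "0 < d" "window p"
  shows "gain p (t \<circ> transpose p (p + 1)) = - gain p t"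
proof -
  have "p - d \<noteq> p" "p - d \<noteq> p + 1" "p + 1 + d \<noteq> p" "p + 1 + d \<noteq> p + 1"
    using assms by (auto simp: window_def)
  then show ?thesis
    by (simp add: gain_def swap_gain_swap[of _ "t p"] transpose_apply_other)
qed

lemma gain_swap_other:
  assumes "0 < d" "window p" "window q" "p + 2 * d + 2 \<le> q \<or> q + 2 * d + 2 \<le> p"
  shows "gain q (t \<circ> transpose p (p + 1)) = gain q t"
  using assms by (auto simp: gain_def window_def transpose_apply_other)

text \<open>The three squares in \<open>swap_gain_squares\<close> are one square evaluated after
  exchanges within a row, so they have equal means, and these sum to at least 1.\<close>

lemma avg_gain_square_ge:
  assumes d: "0 < d" and p: "window p"
  shows "1 / 3 \<le> avg D (\<lambda>t. (gain p t)\<^sup>2)"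
proof -
  let ?g = "\<lambda>t. (gain p t)\<^sup>2"
  have pd: "d < p" "p + 1 + d \<le> n" using p by (auto simp: window_def)
  have 1: "avg D (\<lambda>t. ?g (t \<circ> transpose (p - d) p)) = avg D ?g"
    using window_row[OF p, of p] window_row[OF p, of "p - d"] by (intro avg_swap_row) auto
  have 2: "avg D (\<lambda>t. ?g (t \<circ> transpose (p + 1) (p + 1 + d))) = avg D ?g"
    using window_row[OF p, of "p + 1"] window_row[OF p, of "p + 1 + d"] by (intro avg_swap_row) auto
  have "avg D (\<lambda>_. 1) \<le> avg D (\<lambda>t. ?g t + ?g (t \<circ> transpose (p - d) p) + ?g (t \<circ> transpose (p + 1) (p + 1 + d)))"
  proof (rule avg_mono)
    fix t assume t: "t \<in> D"
    have "distinct [t (p - d), t p, t (p + 1), t (p + 1 + d)]" using D_inj[OF t] d pd by auto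
    from swap_gain_squares[OF this]
    show "1 \<le> ?g t + ?g (t \<circ> transpose (p - d) p) + ?g (t \<circ> transpose (p + 1) (p + 1 + d))"
      using d pd by (simp add: gain_def transpose_apply_other)
  qed
  then show ?thesis unfolding avg_add 1 2 by (simp add: avg_const finite_D D_nonempty)
qed

text \<open>Under the exchange the gain changes sign and \<open>S\<close> drops by the gain, so the
  left side equals the mean squared gain minus itself.\<close>

lemma avg_S_gain:
  assumes d: "0 < d" and p: "window p"
  shows "avg D (\<lambda>t. (S t - c) * gain p t) = avg D (\<lambda>t. (gain p t)\<^sup>2) / 2"
proof -
  let ?sw = "\<lambda>t. t \<circ> transpose p (p + 1)"
  have "avg D (\<lambda>t. (S t - c) * gain p t) = avg D (\<lambda>t. (S (?sw t) - c) * gain p (?sw t))"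
    using window_row[OF p, of p] window_row[OF p, of "p + 1"] by (intro avg_swap_row[symmetric]) auto
  also have "\<dots> = avg D (\<lambda>t. (gain p t)\<^sup>2 - (S t - c) * gain p t)"
  proof (rule avg_cong)
    fix t
    have "S (?sw t) = S t - gain p t" using S_swap_adjacent[OF d p, of t] by simp
    then show "(S (?sw t) - c) * gain p (?sw t) = (gain p t)\<^sup>2 - (S t - c) * gain p t"
      by (simp only: gain_swap_self[OF d p]) (simp add: power2_eq_square algebra_simps)
  qed
  finally show ?thesis unfolding avg_diff by simp
qed

text \<open>The separation makes the windows disjoint: exchanging inside the first flips the sign of
  its gain and leaves the other gain alone.\<close>

lemma avg_gain_gain:
  assumes d: "0 < d" and "window p" "window q" "p + 2 * d + 2 \<le> q \<or> q + 2 * d + 2 \<le> p"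
  shows "avg D (\<lambda>t. gain p t * gain q t) = 0"
proof -
  let ?sw = "\<lambda>t. t \<circ> transpose p (p + 1)"
  have "avg D (\<lambda>t. gain p t * gain q t) = avg D (\<lambda>t. gain p (?sw t) * gain q (?sw t))"
    using window_row[OF assms(2), of p] window_row[OF assms(2), of "p + 1"]
    by (intro avg_swap_row[symmetric]) auto
  also have "\<dots> = avg D (\<lambda>t. (-1) * (gain p t * gain q t))"
    by (simp only: gain_swap_self[OF d assms(2)] gain_swap_other[OF assms]) simp
  finally show ?thesis unfolding avg_cmult by simp
qed

text \<open>Cauchy-Schwarz against the total gain \<open>g\<close>: orthogonality gives E g^2 = q
  and the covariance with \<open>S\<close> is q / 2, so the variance is at least q / 4, where q is
  at least a third of the number of windows.\<close>

lemma variance_ge_windows: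
  assumes d: "0 < d" and fin: "finite P" and win: "\<And>p. p \<in> P \<Longrightarrow> window p"
    and sep: "\<And>p q. p \<in> P \<Longrightarrow> q \<in> P \<Longrightarrow> p < q \<Longrightarrow> p + 2 * d + 2 \<le> q"
  shows "real (card P) / 12 \<le> avg D (\<lambda>t. (S t - avg D S)\<^sup>2)"
proof (cases "P = {}")
  case True
  then show ?thesis by (simp add: avg_nonneg)
next
  case False
  define V where "V = avg D (\<lambda>t. (S t - avg D S)\<^sup>2)"
  define q where "q = (\<Sum>p\<in>P. avg D (\<lambda>t. (gain p t)\<^sup>2))"
  define g where "g t = (\<Sum>p\<in>P. gain p t)" for t
  have q_ge: "real (card P) / 3 \<le> q"
    unfolding q_def using sum_mono[of P "\<lambda>_. 1 / 3", OF avg_gain_square_ge[OF d win]] by simp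
  moreover have "0 < real (card P)" using False fin by (simp add: card_gt_0_iff)
  ultimately have "0 < q" by linarith
  have "avg D (\<lambda>t. (g t)\<^sup>2) = (\<Sum>p\<in>P. \<Sum>p'\<in>P. avg D (\<lambda>t. gain p t * gain p' t))"
    unfolding g_def power2_eq_square sum_product avg_sum ..
  also have "\<dots> = (\<Sum>p\<in>P. avg D (\<lambda>t. gain p t * gain p t))"
  proof (rule sum.cong[OF refl])
    fix p assume p: "p \<in> P"
    have "avg D (\<lambda>t. gain p t * gain p' t) = 0" if "p' \<in> P" "p' \<noteq> p" for p'
    proof (rule avg_gain_gain[OF d])
      show "p + 2 * d + 2 \<le> p' \<or> p' + 2 * d + 2 \<le> p"
        using sep[OF p that(1)] sep[OF that(1) p] that(2) by linarith
    qed (use p that win in auto)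
    then have "(\<Sum>p'\<in>P. avg D (\<lambda>t. gain p t * gain p' t)) =
        (\<Sum>p'\<in>{p}. avg D (\<lambda>t. gain p t * gain p' t))"
      using p fin by (intro sum.mono_neutral_right) auto
    then show "(\<Sum>p'\<in>P. avg D (\<lambda>t. gain p t * gain p' t)) = avg D (\<lambda>t. gain p t * gain p t)" by simp
  qed
  finally have g2: "avg D (\<lambda>t. (g t)\<^sup>2) = q" by (simp add: q_def power2_eq_square)
  have Sg: "avg D (\<lambda>t. (S t - avg D S) * g t) = q / 2"
    unfolding g_def q_def sum_distrib_left avg_sum sum_divide_distrib
    by (intro sum.cong refl avg_S_gain d win)
  have "(q / 2)\<^sup>2 \<le> V * q"
    using avg_Cauchy_Schwarz[of D "\<lambda>t. S t - avg D S" g] unfolding V_def g2 Sg .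
  then have "q / 4 \<le> V" using \<open>0 < q\<close> by (simp add: power2_eq_square field_simps)
  then show ?thesis using q_ge unfolding V_def by linarith
qed

text \<open>Cut the positions into consecutive windows of length \<open>2 * d + 2\<close>. Mapping a window that meets
  several rows to the row of its first position is injective, so at most \<open>I\<close> windows are lost.\<close>

lemma variance_ge:
  assumes d: "0 < d" and rows: "\<And>p. p \<in> {1..n} \<Longrightarrow> row p < I"
  shows "(real (n div (2 * d + 2)) - real I) / 12 \<le> avg D (\<lambda>t. (S t - avg D S)\<^sup>2)"
proof -
  define w where "w = 2 * d + 2"
  define J where "J = {..<n div w}"
  define good where "good = {j \<in> J. row (j * w + 1) = row (j * w + w)}"
  \<comment> \<open>With \<open>p = c j\<close> the window runs exactly from
    \<open>p - d = j * w + 1\<close> to \<open>p + 1 + d = j * w + w\<close>.\<close>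
  define c where "c j = j * w + d + 1" for j
  have in_range: "j * w + w \<le> n" if "j \<in> J" for j
  proof -
    have "Suc j * w \<le> (n div w) * w" using that by (intro mult_le_mono1) (simp add: J_def)
    also have "\<dots> \<le> n" by simp
    finally show ?thesis by simp
  qed
  have step: "j * w + w \<le> k * w" if "j < k" for j k
  proof -
    have "Suc j * w \<le> k * w" using that by (intro mult_le_mono1) simp
    then show ?thesis by simp
  qed
  have "inj_on (\<lambda>j. row (j * w + 1)) (J - good)"
  proof (rule linorder_inj_onI')
    fix j k assume jk: "j \<in> J - good" "k \<in> J - good" "j < k"
    have 1: "1 \<le> w" by (simp add: w_def)
    have "row (j * w + 1) \<le> row (j * w + w)"
      using in_range[of j] jk 1 by (intro mono_onD[OF mono_row]) auto
    \<comment> \<open>A bad window ends in a later row than it starts in, and every further window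
      starts no earlier than that row.\<close>
    then have "row (j * w + 1) < row (j * w + w)" using jk by (auto simp: good_def)
    also have "\<dots> \<le> row (k * w + 1)"
      using in_range[of k] in_range[of j] jk 1 step[of j k] by (intro mono_onD[OF mono_row]) auto
    finally show "row (j * w + 1) \<noteq> row (k * w + 1)" by simp
  qed
  then have "card (J - good) = card ((\<lambda>j. row (j * w + 1)) ` (J - good))" by (rule card_image[symmetric])
  also have "\<dots> \<le> card {..<I}"
  proof (rule card_mono)
    show "(\<lambda>j. row (j * w + 1)) ` (J - good) \<subseteq> {..<I}"
      using in_range by (force intro!: rows simp: w_def)
  qed simp
  finally have "card (J - good) \<le> I" by simp
  moreover have "card (J - good) = card J - card good"
    by (rule card_Diff_subset) (auto simp: good_def J_def)
  ultimately have count: "n div w \<le> card good + I" by (simp add: J_def)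
  have "0 < w" by (simp add: w_def)
  then have "inj c" by (auto simp: inj_def c_def)
  then have "card (c ` good) = card good" by (intro card_image) (auto intro: inj_on_subset)
  moreover have "real (card (c ` good)) / 12 \<le> avg D (\<lambda>t. (S t - avg D S)\<^sup>2)"
  proof (rule variance_ge_windows[OF d])
    show "finite (c ` good)" by (simp add: good_def J_def)
    show "window p" if p: "p \<in> c ` good" for p
    proof -
      obtain j where j: "j \<in> good" "p = c j" using p by blast
      have e: "p - d = j * w + 1" "p + 1 + d = j * w + w" using j by (auto simp: c_def w_def)
      have "j * w + w \<le> n" using j in_range by (auto simp: good_def)
      moreover have "row (j * w + 1) = row (j * w + w)" using j by (simp add: good_def)
      moreover have "d < p" using j by (simp add: c_def)
      ultimately show ?thesis unfolding window_def e by simp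
    qed
    show "p + 2 * d + 2 \<le> q" if pq: "p \<in> c ` good" "q \<in> c ` good" "p < q" for p q
    proof -
      obtain j k where jk: "p = c j" "q = c k" using pq(1,2) by auto
      have "j < k"
      proof (rule ccontr)
        assume "\<not> j < k"
        then have "k * w \<le> j * w" by (intro mult_le_mono1) simp
        then show False using pq jk by (simp add: c_def)
      qed
      then show ?thesis using step[of j k] jk by (simp add: c_def w_def)
    qed
  qed
  moreover have "real (n div w) \<le> real (card good) + real I"
    using of_nat_mono[where 'a=real, OF count] by simp
  ultimately show ?thesis unfolding w_def by simp
qed

end

section \<open>The normal approximation\<close>

context descents_on_young_orbit begin

text \<open>The abstract bound for the standardised count: \<alpha> is half of
  \<open>sum_G_abs_le\<close>, \<beta> comes from \<open>S_act_le\<close>, and \<epsilon> bounds the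
  standard deviation of \<open>H\<close> divided by \<open>v\<close>.\<close>

lemma kolmogorov_bound:
  fixes v :: real
  defines "v \<equiv> avg D (\<lambda>t. (S t - avg D S)\<^sup>2)"
  assumes v: "0 < v" and d: "0 < d" and n: "0 < n"
  shows "(SUP x. \<bar>avg D (\<lambda>t. of_bool ((S t - avg D S) / sqrt v \<le> x)) - cdf std_normal_distribution x\<bar>)
    \<le> 14 * (sqrt (2 * L\<^sup>2 * real n) / v) + 36 * (real d * real n / sqrt v) * (8 * real d / sqrt v)\<^sup>2
      + 2 * (8 * real d / sqrt v)"
proof (rule stein_coupling_kolmogorov[OF finite_D D_nonempty,
    where K=moves and G="\<lambda>k t. G k t / 2 / sqrt v" and X'="\<lambda>k t. (S (act k t) - avg D S) / sqrt v"])
  let ?m = "avg D S"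
  have sq: "sqrt v * sqrt v = v" "0 < sqrt v" using v by auto
  show "avg D (\<lambda>t. (S t - ?m) / sqrt v * f ((S t - ?m) / sqrt v)) =
      avg D (\<lambda>t. \<Sum>k\<in>moves. G k t / 2 / sqrt v * (f ((S t - ?m) / sqrt v) - f ((S (act k t) - ?m) / sqrt v)))" for f
  proof -
    have "avg D (\<lambda>t. (S t - ?m) / sqrt v * f ((S t - ?m) / sqrt v)) =
        avg D (\<lambda>t. (S t - ?m) * f ((S t - ?m) / sqrt v)) / sqrt v"
      unfolding avg_divide[symmetric] by simp
    also have "\<dots> = avg D (\<lambda>t. (\<Sum>k\<in>moves. G k t / 2 *
        (f ((S t - ?m) / sqrt v) - f ((S (act k t) - ?m) / sqrt v))) / sqrt v)"
      unfolding stein_identity[of "\<lambda>y. f ((y - ?m) / sqrt v)"] avg_divide ..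
    also have "\<dots> = avg D (\<lambda>t. \<Sum>k\<in>moves. G k t / 2 / sqrt v *
        (f ((S t - ?m) / sqrt v) - f ((S (act k t) - ?m) / sqrt v)))"
      unfolding sum_divide_distrib by (intro avg_cong sum.cong refl) simp
    finally show ?thesis .
  qed
  show "\<bar>(S t - ?m) / sqrt v - (S (act k t) - ?m) / sqrt v\<bar> \<le> 8 * real d / sqrt v" for t k
    using S_act_le[of t k] sq by (simp add: diff_divide_distrib[symmetric] abs_divide divide_right_mono)
  show "(\<Sum>k\<in>moves. \<bar>G k t / 2 / sqrt v\<bar>) \<le> real d * real n / sqrt v" for t
  proof -
    have "(\<Sum>k\<in>moves. \<bar>G k t / 2 / sqrt v\<bar>) = (\<Sum>k\<in>moves. \<bar>G k t\<bar>) / (2 * sqrt v)"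
      using sq by (simp add: sum_divide_distrib abs_divide)
    also have "\<dots> \<le> (2 * real d * real n) / (2 * sqrt v)"
      using sq sum_G_abs_le[of t] by (intro divide_right_mono) auto
    finally show ?thesis by simp
  qed
  show "0 < real d * real n / sqrt v" "0 < 8 * real d / sqrt v" using sq d n by auto
  have "avg D (\<lambda>t. ((S t - ?m) / sqrt v)\<^sup>2) = avg D (\<lambda>t. (S t - ?m)\<^sup>2) / v"
    unfolding power_divide real_sqrt_pow2[OF less_imp_le[OF v]] avg_divide ..
  also have "\<dots> = 1" using v by (simp add: v_def)
  finally show "avg D (\<lambda>t. ((S t - ?m) / sqrt v)\<^sup>2) = 1" .
  have "avg D (\<lambda>t. \<bar>1 - (\<Sum>k\<in>moves. G k t / 2 / sqrt v * ((S t - ?m) / sqrt v - (S (act k t) - ?m) / sqrt v))\<bar>)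
      = avg D (\<lambda>t. \<bar>(H t - v) / v\<bar>)"
  proof (rule avg_cong)
    fix t
    have "(\<Sum>k\<in>moves. G k t / 2 / sqrt v * ((S t - ?m) / sqrt v - (S (act k t) - ?m) / sqrt v)) = H t / v"
      unfolding H_def sum_divide_distrib
      by (intro sum.cong refl) (use v in \<open>simp add: diff_divide_distrib[symmetric] abs_of_pos\<close>)
    then show "\<bar>1 - (\<Sum>k\<in>moves. G k t / 2 / sqrt v * ((S t - ?m) / sqrt v - (S (act k t) - ?m) / sqrt v))\<bar>
        = \<bar>(H t - v) / v\<bar>"
      using v by (simp add: diff_divide_distrib abs_minus_commute)
  qed
  also have "\<dots> \<le> sqrt (avg D (\<lambda>t. ((H t - v) / v)\<^sup>2))"
    by (rule avg_abs_le_sqrt[OF finite_D D_nonempty])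
  also have "avg D (\<lambda>t. ((H t - v) / v)\<^sup>2) = avg D (\<lambda>t. (H t - avg D H)\<^sup>2) / v\<^sup>2"
    unfolding power_divide avg_divide by (simp add: avg_H v_def)
  also have "sqrt \<dots> \<le> sqrt (2 * L\<^sup>2 * real n / v\<^sup>2)"
    by (intro real_sqrt_le_mono divide_right_mono variance_H_le) simp
  also have "\<dots> = sqrt (2 * L\<^sup>2 * real n) / v"
    using v by (simp add: real_sqrt_divide)
  finally show "avg D (\<lambda>t. \<bar>1 - (\<Sum>k\<in>moves. G k t / 2 / sqrt v *
      ((S t - ?m) / sqrt v - (S (act k t) - ?m) / sqrt v))\<bar>) \<le> sqrt (2 * L\<^sup>2 * real n) / v" .
qed

section \<open>Transfer to the law of the standardised count\<close>

lemma des_mean_eq: "des_mean d n D = avg D S"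
  by (simp add: des_mean_def S_def[abs_def] expectation_pmf_of_set_eq_avg finite_D D_nonempty)

lemma des_sd_eq: "des_sd d n D = sqrt (avg D (\<lambda>t. (S t - avg D S)\<^sup>2))"
  by (simp add: des_sd_def S_def[abs_def] expectation_pmf_of_set_eq_avg finite_D D_nonempty)

lemma cdf_W_law:
  "cdf (W_law d n D) x =
    avg D (\<lambda>t. of_bool ((S t - avg D S) / sqrt (avg D (\<lambda>t. (S t - avg D S)\<^sup>2)) \<le> x))"
proof -
  have "cdf (W_law d n D) x = measure_pmf.prob (pmf_of_set D) {t. W d n D t \<le> x}"
    by (simp add: cdf_def W_law_def measure_distr vimage_def)
  also have "\<dots> = measure_pmf.expectation (pmf_of_set D) (\<lambda>t. indicat_real {t. W d n D t \<le> x} t)"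
    by simp
  also have "\<dots> = avg D (\<lambda>t. of_bool (W d n D t \<le> x))"
    unfolding expectation_pmf_of_set_eq_avg[OF finite_D D_nonempty]
    by (rule avg_cong) (simp add: indicator_def)
  finally show ?thesis by (simp add: W_def des_mean_eq des_sd_eq S_def)
qed

text \<open>Once the variance is at least of order n, all three error terms have order n^(-1/2). The
  constant is 2304 = 36 * 8^2.\<close>

lemma kolmogorov_dist_le:
  fixes c :: real
  assumes c: "0 < c" "c * real n \<le> avg D (\<lambda>t. (S t - avg D S)\<^sup>2)" and d: "0 < d" and n: "0 < n"
  shows "kolmogorov_dist (W_law d n D) std_normal_distribution
    \<le> (14 * sqrt 2 * L / c + 2304 * real d ^ 3 / (c * sqrt c) + 16 * real d / sqrt c) / sqrt (real n)"
proof -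
  define v where "v = avg D (\<lambda>t. (S t - avg D S)\<^sup>2)"
  have "0 < c * real n" using c n by simp
  moreover have "c * real n \<le> v" using c unfolding v_def by simp
  ultimately have cn: "0 < c * real n" "c * real n \<le> v" "0 < v" by linarith+
  have L: "0 \<le> L" by (simp add: L_def)
  have sq: "0 < sqrt c" "0 < sqrt (real n)" "sqrt (real n) * sqrt (real n) = real n" using c n by auto
  have sv: "sqrt c * sqrt (real n) \<le> sqrt v" using cn(2) by (simp add: real_sqrt_mult[symmetric])
  have "kolmogorov_dist (W_law d n D) std_normal_distribution \<le>
      14 * (sqrt (2 * L\<^sup>2 * real n) / v) + 36 * (real d * real n / sqrt v) * (8 * real d / sqrt v)\<^sup>2
      + 2 * (8 * real d / sqrt v)"
    unfolding kolmogorov_dist_def cdf_W_law v_def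
    by (rule kolmogorov_bound[OF cn(3)[unfolded v_def] d n])
  also have "\<dots> = 14 * sqrt 2 * L * sqrt (real n) / v + 2304 * real d ^ 3 * real n / (v * sqrt v) + 16 * real d / sqrt v"
    using L cn by (simp add: real_sqrt_mult power_divide power_mult_distrib power3_eq_cube power2_eq_square mult_ac)
  also have "\<dots> \<le> 14 * sqrt 2 * L * sqrt (real n) / (c * real n)
      + 2304 * real d ^ 3 * real n / ((c * real n) * (sqrt c * sqrt (real n)))
      + 16 * real d / (sqrt c * sqrt (real n))"
    using cn sq L c n by (intro add_mono divide_left_mono mult_mono sv) auto
  also have "\<dots> = (14 * sqrt 2 * L / c + 2304 * real d ^ 3 / (c * sqrt c) + 16 * real d / sqrt c) / sqrt (real n)"
  proof -
    have "sqrt (real n) / (c * real n) = 1 / c / sqrt (real n)"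
      using sq c by (simp add: field_simps)
    moreover have "real n / ((c * real n) * (sqrt c * sqrt (real n))) = 1 / (c * sqrt c) / sqrt (real n)"
      using c n by simp
    ultimately show ?thesis
      unfolding times_divide_eq_right[symmetric] add_divide_distrib by simp
  qed
  finally show ?thesis .
qed

end

section \<open>Blocks of a partition as colour classes\<close>

lemma parabolic_eq_young: "parabolic l = young {1..sum_list l} (block_index l)"
proof -
  \<comment> \<open>Outside \<open>{1..sum_list l}\<close> the permutation fixes every point, so the
    colour condition holds there.\<close>
  have "(\<forall>p\<in>{1..sum_list l}. block_index l (s p) = block_index l p) \<longleftrightarrow>
      (\<forall>p. block_index l (s p) = block_index l p)" if "s permutes {1..sum_list l}" for s
    using permutes_not_in[OF that] by metis
  then show ?thesis by (auto simp: parabolic_iff young_def)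
qed

lemma mono_block_index: "mono_on {1..sum_list l} (block_index l)"
proof (rule mono_onI)
  fix p q assume p: "p \<in> {1..sum_list l}" and q: "q \<in> {1..sum_list l}" and "p \<le> q"
  obtain i j where i: "p \<in> block l i" and j: "q \<in> block l j" using block_cover p q by metis
  have "i \<le> j"
  proof (rule ccontr)
    assume "\<not> i \<le> j"
    then have "sum_list (take (Suc j) l) \<le> sum_list (take i l)" by (intro sum_list_take_mono) simp
    then show False using i j \<open>p \<le> q\<close> by (auto simp: block_def)
  qed
  then show "block_index l p \<le> block_index l q" using i j by (simp add: block_index_eq)
qed

lemma kolmogorov_dist_nonneg:
  assumes "prob_space M" "sets M = sets borel"
  shows "0 \<le> kolmogorov_dist M std_normal_distribution"
    and "\<bar>cdf M x - cdf std_normal_distribution x\<bar> \<le> kolmogorov_dist M std_normal_distribution"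
proof -
  interpret M: prob_space M by fact
  have "\<bar>cdf M y - cdf std_normal_distribution y\<bar> \<le> 1" for y
    using std_normal.cdf_nonneg[of y] std_normal.cdf_bounded_prob[of y] M.prob_le_1[of "{..y}"]
      measure_nonneg[of M "{..y}"]
    unfolding cdf_def[of M] by linarith
  then have "bdd_above (range (\<lambda>x. \<bar>cdf M x - cdf std_normal_distribution x\<bar>))"
    by (intro bdd_aboveI2)
  then show *: "\<bar>cdf M x - cdf std_normal_distribution x\<bar> \<le> kolmogorov_dist M std_normal_distribution" for x
    unfolding kolmogorov_dist_def by (rule cSUP_upper[rotated]) simp
  show "0 \<le> kolmogorov_dist M std_normal_distribution" using *[of 0] by linarith
qed

theorem theorem1p3:
  fixes lam mu :: "nat \<Rightarrow> nat list"
    and D :: "nat \<Rightarrow> (nat \<Rightarrow> nat) set"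
    and d :: nat
  assumes lam: "\<And>n. is_partition (lam n) n"
    and mu: "\<And>n. is_partition (mu n) n"
    and I_small: "(\<lambda>n. real (length (lam n))) \<in> o(\<lambda>n. real n)"
    and D: "\<And>n. D n \<in> double_cosets n (lam n) (mu n)"
    and d_pos: "0 < d"
    and d_le: "eventually (\<lambda>n. real d \<le> real (last (lam n)) / 2) sequentially"
  shows "(\<lambda>n. kolmogorov_dist (W_law d n (D n)) std_normal_distribution)
           \<in> O(\<lambda>n. real n powr (-1/2)) \<and>
         weak_conv_m (\<lambda>n. W_law d n (D n)) std_normal_distribution"
proof -
  define w where "w = 2 * d + 2"
  \<comment> \<open>With y = n / w, at most y / 4 rows and y \<ge> 2, the count in
    \<open>variance_ge\<close> is at least y - 1 - y / 4 \<ge> y / 4, and it is divided by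
    12.\<close>
  define c :: real where "c = 1 / (48 * real w)"
  \<comment> \<open>\<open>L\<close> is spelled out because its locale is interpreted separately for
    each n; its value depends on \<open>d\<close> alone, so C is uniform in n.\<close>
  define C where "C = 14 * sqrt 2 * (48 * real d * (2 * real d + 1) * (real d + real d * real d)) / c
    + 2304 * real d ^ 3 / (c * sqrt c) + 16 * real d / sqrt c"
  define K where "K n = kolmogorov_dist (W_law d n (D n)) std_normal_distribution" for n
  have w: "0 < w" by (simp add: w_def)
  then have c: "0 < c" by (simp add: c_def)
  have law: "prob_space (W_law d n (D n))" "sets (W_law d n (D n)) = sets borel" for n
    unfolding W_law_def by (auto intro: measure_pmf.prob_space_distr)
  have "eventually (\<lambda>n. real (length (lam n)) \<le> 1 / (4 * real w) * real n) sequentially"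
    using landau_o.smallD[OF I_small, of "1 / (4 * real w)"] w by simp
  then have bound: "eventually (\<lambda>n. K n \<le> C * real n powr (-1/2)) sequentially"
    using eventually_ge_at_top[of "2 * w"]
  proof eventually_elim
    case (elim n)
    have n: "0 < n" using elim w by simp
    have sums: "sum_list (lam n) = n" "sum_list (mu n) = n"
      using lam[of n] mu[of n] by (auto simp: is_partition_def)
    obtain s where s: "s permutes {1..n}" and Ds: "D n = double_coset (lam n) (mu n) s"
      using D[of n] by (auto simp: double_cosets_def)
    interpret descents_on_young_orbit n d "block_index (lam n)" "block_index (mu n)" s "D n"
    proof
      show "D n = {b \<circ> s \<circ> a |a b. a \<in> young {1..n} (block_index (lam n)) \<and> b \<in> young {1..n} (block_index (mu n))}"
        unfolding Ds double_coset_def parabolic_eq_young sums ..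
    qed (use s mono_block_index[of "lam n"] mono_block_index[of "mu n"] sums in auto)
    define y where "y = real n / real w"
    have "(real (n div w) - real (length (lam n))) / 12 \<le> avg (D n) (\<lambda>t. (S t - avg (D n) S)\<^sup>2)"
      unfolding w_def using block_index_less[of _ "lam n"] sums by (intro variance_ge d_pos) auto
    moreover have "y - 1 \<le> real (n div w)"
    proof -
      have "real n \<le> real (w + w * (n div w))"
        using dividend_less_times_div[OF w, of n] by (intro of_nat_mono) simp
      then show ?thesis using w by (simp add: y_def field_simps)
    qed
    moreover have "2 \<le> y" using elim w by (simp add: y_def field_simps)
    moreover have "real (length (lam n)) \<le> y / 4" using elim(1) by (simp add: y_def)
    moreover have "y / 48 \<le> V" if "(a - b) / 12 \<le> V" "y - 1 \<le> a" "2 \<le> y" "b \<le> y / 4" for a b V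
      using that by (simp add: field_simps)
    moreover have "c * real n = y / 48" by (simp add: c_def y_def)
    ultimately have "c * real n \<le> avg (D n) (\<lambda>t. (S t - avg (D n) S)\<^sup>2)" by metis
    from kolmogorov_dist_le[OF c this d_pos n]
    have "K n \<le> C / sqrt (real n)" unfolding K_def C_def L_def .
    moreover have "real n powr (- (1/2)) = 1 / sqrt (real n)"
      using n by (simp add: powr_minus_divide powr_half_sqrt)
    ultimately show ?case by simp
  qed
  have "K \<in> O(\<lambda>n. real n powr (-1/2))"
  proof (rule bigoI)
    show "eventually (\<lambda>n. norm (K n) \<le> C * norm (real n powr (-1/2))) sequentially"
      using bound by eventually_elim (use kolmogorov_dist_nonneg(1)[OF law] in \<open>auto simp: K_def\<close>)
  qed
  moreover have "weak_conv_m (\<lambda>n. W_law d n (D n)) std_normal_distribution"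
    unfolding weak_conv_m_def weak_conv_def
  proof (intro allI impI)
    fix x
    have "(\<lambda>n. C * real n powr (-1/2)) \<longlonglongrightarrow> C * 0"
      by (intro tendsto_mult_left) real_asymp
    then have lim: "(\<lambda>n. C * real n powr (-1/2)) \<longlonglongrightarrow> 0" by simp
    have "(\<lambda>n. cdf (W_law d n (D n)) x - cdf std_normal_distribution x) \<longlonglongrightarrow> 0"
    proof (rule Lim_null_comparison[OF _ lim])
      show "eventually (\<lambda>n. norm (cdf (W_law d n (D n)) x - cdf std_normal_distribution x)
          \<le> C * real n powr (-1/2)) sequentially"
        using bound by eventually_elim
          (use kolmogorov_dist_nonneg(2)[OF law] in \<open>auto simp: K_def intro: order_trans\<close>)
    qed
    then show "(\<lambda>n. cdf (W_law d n (D n)) x) \<longlonglongrightarrow> cdf std_normal_distribution x"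
      by (simp add: LIM_zero_iff)
  qed
  ultimately show ?thesis unfolding K_def[abs_def] by blast
qed

end
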